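(* Let $\alpha$ be a polygon coloring of the plane $\mathbb{R}^2$. If $\alpha$ contains a vertex of degree at least $4$, then $\alpha$ uses at least $7$ colors.
   Context: A polygon coloring is a mapping from $\mathbb{R}^2$ to a finite set of colors such that any two points at distance one are colored differently, and the plane is partitioned into regions, borders and vertices as follows. Vertices are points; borders are open line segments whose endpoints are vertices; regions are uniformly colored (all points of a region get the same color) open polygons enclosed by borders and vertices (not necessarily convex). Any regions enclosed by (i.e. sharing) the same vertex or the same border are colored differently. A point is called a vertex only if there exists a pair of borders connected to it forming an angle other than $\pi$. The coloring is locally finite: any disk meets only finitely many regions, borders and vertices. Borders and vertices themselves may be colored arbitrarily. The degree of a vertex is the number of borders connected to it. *)

theory Defs
  imports "HOL-Analysis.Analysis"
begin

fun polygonal_path :: "(real^2) list \<Rightarrow> real \<Rightarrow> real^2" where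
  "polygonal_path [] = linepath 0 0"
| "polygonal_path [a] = linepath a a"
| "polygonal_path [a, b] = linepath a b"
| "polygonal_path (a # b # c # xs) = linepath a b +++ polygonal_path (b # c # xs)"

definition polygon_boundary :: "(real^2) list \<Rightarrow> real \<Rightarrow> real^2" where
  "polygon_boundary vs = polygonal_path (vs @ [hd vs])"

text \<open>
  Consecutive sides of a simple polygon may be collinear: a region can have a boundary vertex
  at which it has a straight angle, because other borders end there from the other side.
\<close>

definition simple_polygon :: "(real^2) list \<Rightarrow> bool" where
  "simple_polygon vs \<longleftrightarrow> 3 \<le> length vs \<and> simple_path (polygon_boundary vs)"

definition open_polygon :: "(real^2) list \<Rightarrow> (real^2) set" where
  "open_polygon vs = inside (path_image (polygon_boundary vs))"

text \<open>The unoriented angle at \<open>v\<close> between the rays towards \<open>a\<close> and \<open>b\<close>, in \<open>[0, pi]\<close>.\<close>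

definition angle_at :: "real^2 \<Rightarrow> real^2 \<Rightarrow> real^2 \<Rightarrow> real" where
  "angle_at v a b = arccos (((a - v) \<bullet> (b - v)) / (norm (a - v) * norm (b - v)))"

definition connected_to :: "(real^2) set \<Rightarrow> real^2 \<Rightarrow> bool" where
  "connected_to b v \<longleftrightarrow> (\<exists>w. w \<noteq> v \<and> b = open_segment v w)"

definition vertex_degree :: "(real^2) set set \<Rightarrow> real^2 \<Rightarrow> nat" where
  "vertex_degree B v = card {b \<in> B. connected_to b v}"

definition locally_finite_family :: "(real^2) set set \<Rightarrow> bool" where
  "locally_finite_family F \<longleftrightarrow> (\<forall>x e. finite {S \<in> F. S \<inter> cball x e \<noteq> {}})"

text \<open>
  \<open>polygon_coloring \<alpha> V B R\<close>: the colouring \<open>\<alpha>\<close> together with its vertices \<open>V\<close>, borders \<open>B\<close>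
  and regions \<open>R\<close>. The unit-distance condition applies to all points of the plane; apart from
  it, the colours of points on borders and of vertices are unrestricted.
\<close>

definition polygon_coloring ::
  "(real^2 \<Rightarrow> 'c) \<Rightarrow> (real^2) set \<Rightarrow> (real^2) set set \<Rightarrow> (real^2) set set \<Rightarrow> bool" where
  "polygon_coloring \<alpha> V B R \<longleftrightarrow>
     finite (range \<alpha>) \<and>
     (\<forall>x y. dist x y = 1 \<longrightarrow> \<alpha> x \<noteq> \<alpha> y) \<and>
     partition_on UNIV (R \<union> B \<union> (\<lambda>v. {v}) ` V) \<and>
     locally_finite_family (R \<union> B \<union> (\<lambda>v. {v}) ` V) \<and>
     (\<forall>b\<in>B. \<exists>u\<in>V. \<exists>w\<in>V. u \<noteq> w \<and> b = open_segment u w) \<and>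
     (\<forall>r\<in>R. \<exists>vs. simple_polygon vs \<and> r = open_polygon vs \<and> set vs \<subseteq> V \<and>
        (\<forall>i<length vs. open_segment (vs ! i) (vs ! (Suc i mod length vs)) \<in> B)) \<and>
     (\<forall>r\<in>R. \<forall>x\<in>r. \<forall>y\<in>r. \<alpha> x = \<alpha> y) \<and>
     (\<forall>r\<in>R. \<forall>s\<in>R. r \<noteq> s \<and>
        ((\<exists>v\<in>V. v \<in> frontier r \<and> v \<in> frontier s) \<or>
         (\<exists>b\<in>B. b \<subseteq> frontier r \<and> b \<subseteq> frontier s)) \<longrightarrow>
        (\<forall>x\<in>r. \<forall>y\<in>s. \<alpha> x \<noteq> \<alpha> y)) \<and>
     (\<forall>v\<in>V. \<exists>a b. a \<noteq> v \<and> b \<noteq> v \<and> a \<noteq> b \<and>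
        open_segment v a \<in> B \<and> open_segment v b \<in> B \<and> angle_at v a b \<noteq> pi)"

end

theory Submission
  imports Defs
begin

text \<open>
  Suppose that there are at most six colours. If \<open>c\<close> lies in the closure of regions of at least four
  colours, then moving \<open>c\<close> slightly into each of these regions excludes their colours from all
  regions met by the unit circle around \<open>c\<close>. Points at angular distance \<open>\<pi>/3\<close> on this
  circle have unit distance, so exactly two colours remain and they alternate along the circle, which
  therefore changes its colour at the six corners \<open>x\<^sub>k\<close> of a regular hexagon. The unit circles
  around \<open>x\<^sub>k\<close> and around \<open>c\<close> cross at \<open>x\<^bsub>k+1\<^esub>\<close>, and their four arcs there lie in four
  different regions, so that \<open>x\<^bsub>k+1\<^esub>\<close> is again a vertex of the same kind. Counting colours, the
  pairs of colours on the circles around the \<open>x\<^sub>k\<close> depend only on the parity of \<open>k\<close>. If \<open>c\<close> is a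
  vertex, the arcs in which these six circles leave \<open>c\<close> take colours alternately from two disjoint
  pairs; two of the three arcs with \<open>k\<close> odd then lie in the same region and are separated on both
  sides by other regions, although the boundary of a simple polygon has only two sides at \<open>c\<close>.
\<close>

subsection \<open>Directions, circles and polygons\<close>

definition dir :: "real \<Rightarrow> real^2" where
  "dir \<theta> = vector [cos \<theta>, sin \<theta>]"

lemma dir_nth [simp]: "dir \<theta> $ 1 = cos \<theta>" "dir \<theta> $ 2 = sin \<theta>"
  by (simp_all add: dir_def)

lemma norm_dir [simp]: "norm (dir \<theta>) = 1"
  by (simp add: norm_eq_sqrt_inner inner_vec_def sum_2 flip: power2_eq_square)

lemma dir_nonzero [simp]: "dir \<theta> \<noteq> 0"
  using norm_dir[of \<theta>] by force

lemma dir_eq_iff: "dir x = dir y \<longleftrightarrow> (\<exists>n::int. x = y + 2 * pi * n)"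
proof -
  have "dir x = dir y \<longleftrightarrow> sin x = sin y \<and> cos x = cos y"
    by (auto simp: vec_eq_iff forall_2)
  then show ?thesis
    by (simp add: sin_cos_eq_iff)
qed

lemma dir_add_2pi [simp]: "dir (\<theta> + 2 * pi) = dir \<theta>"
  by (simp add: vec_eq_iff forall_2)

lemma dir_add_pi [simp]: "dir (\<theta> + pi) = - dir \<theta>"
  by (simp add: vec_eq_iff forall_2)

lemma dir_neq:
  assumes "x < y" "y < x + 2 * pi"
  shows "dir x \<noteq> dir y"
proof
  assume "dir x = dir y"
  then obtain n :: int where n: "y = x + 2 * pi * n"
    by (metis dir_eq_iff)
  then have "0 < real_of_int n" "real_of_int n < 1"
    using assms by (auto simp: zero_less_mult_iff)
  then show False by simp
qed

lemma continuous_on_dir [continuous_intros]: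
  fixes f :: "real \<Rightarrow> real"
  shows "continuous_on S f \<Longrightarrow> continuous_on S (\<lambda>t. dir (f t))"
proof -
  assume "continuous_on S f"
  then have "continuous_on S (\<lambda>t. (\<chi> i. if i = 1 then cos (f t) else sin (f t)) :: real^2)"
  proof (intro continuous_on_vec_lambda)
    fix i :: 2
    assume "continuous_on S f"
    then show "continuous_on S (\<lambda>t. if i = 1 then cos (f t) else sin (f t))"
      by (cases "i = 1") (auto intro!: continuous_intros)
  qed
  then show ?thesis
    by (rule continuous_on_eq) (simp add: vec_eq_iff forall_2)
qed

lemma exists_dir:
  assumes "norm x = 1"
  obtains \<theta> where "0 \<le> \<theta>" "\<theta> < 2 * pi" "x = dir \<theta>"
proof -
  have "(x$1)\<^sup>2 + (x$2)\<^sup>2 = 1"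
    using assms by (simp add: norm_eq_sqrt_inner inner_vec_def sum_2 power2_eq_square)
  then obtain t where "0 \<le> t" "t < 2 * pi" "x$1 = cos t" "x$2 = sin t"
    using sincos_total_2pi by metis
  then show ?thesis
    by (intro that[of t]) (auto simp: vec_eq_iff forall_2)
qed

text \<open>Tangent-chord angle: the chord of an arc of length \<open>2 * \<tau>\<close> makes the
  angle \<open>\<tau>\<close> with the tangent. This form describes an arc in polar coordinates
  around its initial point.\<close>

lemma dir_add_eq_chord: "dir (\<phi> + 2 * \<tau>) = dir \<phi> + (2 * sin \<tau>) *\<^sub>R dir (\<phi> + pi/2 + \<tau>)"
proof -
  have "cos (\<phi> + 2 * \<tau>) - cos \<phi> = - (2 * sin \<tau> * sin (\<phi> + \<tau>))"
    by (simp add: cos_diff_cos sin_diff cos_diff field_simps add_divide_distrib)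
  moreover have "sin (\<phi> + 2 * \<tau>) - sin \<phi> = 2 * sin \<tau> * cos (\<phi> + \<tau>)"
    by (simp add: sin_diff_sin field_simps add_divide_distrib)
  moreover have "cos (\<phi> + pi/2 + \<tau>) = - sin (\<phi> + \<tau>)" "sin (\<phi> + pi/2 + \<tau>) = cos (\<phi> + \<tau>)"
    using minus_sin_cos_eq[of "\<phi> + \<tau>"] sin_cos_eq[of "\<phi> + pi/2 + \<tau>"] cos_minus[of "\<phi> + \<tau>"]
    by (simp_all add: algebra_simps)
  ultimately show ?thesis
    by (simp add: vec_eq_iff forall_2 algebra_simps)
qed

lemma dir_chord:
  assumes "s = 1 \<or> s = -1"
  shows "dir (\<phi> + s * (2 * \<tau>)) = dir \<phi> + (2 * sin \<tau>) *\<^sub>R dir (\<phi> + s * (pi/2) + s * \<tau>)"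
proof (cases "s = 1")
  case True
  then show ?thesis using dir_add_eq_chord[of \<phi> \<tau>] by simp
next
  case False
  then have "s = -1" using assms by simp
  \<comment> \<open>Replacing \<open>\<tau>\<close> by \<open>-\<tau>\<close> changes the sign of
    the sine, which a half turn of the direction absorbs.\<close>
  moreover have "dir (\<phi> - 2 * \<tau>) = dir \<phi> + (2 * sin \<tau>) *\<^sub>R dir (\<phi> - pi/2 - \<tau>)"
    using dir_add_eq_chord[of \<phi> "-\<tau>"] dir_add_pi[of "\<phi> - pi/2 - \<tau>"] by (simp add: algebra_simps)
  ultimately show ?thesis by simp
qed

lemma norm_dir_diff_sixty: "norm (dir (\<theta> + pi/3) - dir \<theta>) = 1"
proof -
  have "dir (\<theta> + pi/3) = dir \<theta> + dir (\<theta> + pi/2 + pi/6)"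
    using dir_add_eq_chord[of \<theta> "pi/6"] by (simp add: sin_30)
  then show ?thesis by simp
qed

text \<open>Since \<open>2 * sin (pi/6) = 1\<close>, the chord of sixty degrees is itself a unit
  vector. Hence consecutive corners of the hexagon lie on each other's unit circles.\<close>

lemma dir_sixty: "dir (\<theta> + pi/3) = dir \<theta> + dir (\<theta> + 2*pi/3)"
proof -
  have "dir (\<theta> + pi/3) = dir \<theta> + dir (\<theta> + pi/2 + pi/6)"
    using dir_add_eq_chord[of \<theta> "pi/6"] by (simp add: sin_30)
  moreover have "\<theta> + pi/2 + pi/6 = \<theta> + 2*pi/3" by simp
  ultimately show ?thesis by metis
qed

section \<open>Sets that leave a point in at most two directions\<close>

text \<open>Common local shape of a polygon boundary at a point and of the borders around a point
  that is not a vertex. One direction or none is also allowed; spare values of \<open>w1\<close> and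
  \<open>w2\<close> are arbitrary.\<close>

definition thin_at :: "(real^2) set \<Rightarrow> real^2 \<Rightarrow> bool" where
  "thin_at P p \<longleftrightarrow> (\<exists>w1 w2. \<exists>\<delta>>0. \<forall>\<rho> \<theta>. 0 < \<rho> \<and> \<rho> < \<delta> \<and> p + \<rho> *\<^sub>R dir \<theta> \<in> P \<longrightarrow> dir \<theta> = w1 \<or> dir \<theta> = w2)"

lemma dir_of_mem_segment:
  assumes "p + \<rho> *\<^sub>R dir \<theta> \<in> closed_segment p w" "0 < \<rho>"
  shows "dir \<theta> = (w - p) /\<^sub>R norm (w - p)"
proof -
  obtain u where u: "0 \<le> u" "p + \<rho> *\<^sub>R dir \<theta> = (1 - u) *\<^sub>R p + u *\<^sub>R w"
    using assms(1) by (auto simp: in_segment)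
  then have e: "\<rho> *\<^sub>R dir \<theta> = u *\<^sub>R (w - p)"
    by (simp add: algebra_simps)
  then have n: "\<rho> = u * norm (w - p)"
    using assms(2) u(1) by (metis abs_of_nonneg less_eq_real_def mult.right_neutral norm_dir norm_scaleR)
  then have "u \<noteq> 0" using assms(2) by auto
  have "dir \<theta> = (1/\<rho>) *\<^sub>R (\<rho> *\<^sub>R dir \<theta>)" using assms(2) by simp
  also have "\<dots> = (w - p) /\<^sub>R norm (w - p)"
    unfolding e using n \<open>u \<noteq> 0\<close> by (simp add: divide_simps)
  finally show ?thesis .
qed

text \<open>A small ball around \<open>p\<close> misses the closed remainder \<open>S\<close>; what
  is left of \<open>P\<close> there lies on two segments out of \<open>p\<close>, each with a single
  direction.\<close>

lemma thin_at_segments: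
  assumes "P \<inter> ball p e \<subseteq> closed_segment p a \<union> closed_segment p b \<union> S" "e > 0" "closed S" "p \<notin> S"
  shows "thin_at P p"
proof -
  obtain d where d: "d > 0" "ball p d \<inter> S = {}"
    using assms(3,4) by (metis Compl_iff disjoint_eq_subset_Compl open_Compl open_contains_ball)
  show ?thesis unfolding thin_at_def
  proof (intro exI conjI allI impI)
    show "min d e > 0" using d assms by simp
    fix \<rho> \<theta> assume *: "0 < \<rho> \<and> \<rho> < min d e \<and> p + \<rho> *\<^sub>R dir \<theta> \<in> P"
    let ?x = "p + \<rho> *\<^sub>R dir \<theta>"
    have "?x \<in> P \<inter> ball p e" "?x \<in> ball p d"
      using * by (simp_all add: dist_norm)
    then have "?x \<in> closed_segment p a \<union> closed_segment p b \<union> S" "?x \<notin> S"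
      using d(2) subsetD[OF assms(1)] by blast+
    then have "?x \<in> closed_segment p a \<or> ?x \<in> closed_segment p b"
      by simp
    then show "dir \<theta> = (a - p) /\<^sub>R norm (a - p) \<or> dir \<theta> = (b - p) /\<^sub>R norm (b - p)"
      using dir_of_mem_segment * by blast
  qed
qed

text \<open>Three angles within less than a full turn have three different directions, too many for
  \<open>w1\<close> and \<open>w2\<close>.\<close>

lemma thin_atD:
  assumes "thin_at P p"
  shows "\<exists>\<delta>>0. \<forall>\<rho> x y z. 0 < \<rho> \<and> \<rho> < \<delta> \<and> x < y \<and> y < z \<and> z < x + 2 * pi \<and>
    p + \<rho> *\<^sub>R dir x \<in> P \<and> p + \<rho> *\<^sub>R dir y \<in> P \<longrightarrow> p + \<rho> *\<^sub>R dir z \<notin> P"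
proof -
  obtain w1 w2 \<delta> where d: "\<delta> > 0"
    "\<forall>\<rho> \<theta>. 0 < \<rho> \<and> \<rho> < \<delta> \<and> p + \<rho> *\<^sub>R dir \<theta> \<in> P \<longrightarrow> dir \<theta> = w1 \<or> dir \<theta> = w2"
    using assms unfolding thin_at_def by metis
  show ?thesis
  proof (intro exI[of _ \<delta>] conjI allI impI notI d(1))
    fix \<rho> x y z :: real
    assume *: "0 < \<rho> \<and> \<rho> < \<delta> \<and> x < y \<and> y < z \<and> z < x + 2 * pi \<and>
      p + \<rho> *\<^sub>R dir x \<in> P \<and> p + \<rho> *\<^sub>R dir y \<in> P" and z: "p + \<rho> *\<^sub>R dir z \<in> P"
    then have "dir x \<noteq> dir y" "dir y \<noteq> dir z" "dir x \<noteq> dir z"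
      using dir_neq[of x y] dir_neq[of y z] dir_neq[of x z] by linarith+
    moreover have "dir x = w1 \<or> dir x = w2" "dir y = w1 \<or> dir y = w2" "dir z = w1 \<or> dir z = w2"
      using d(2)[rule_format, of \<rho> x] d(2)[rule_format, of \<rho> y] d(2)[rule_format, of \<rho> z] * z
      by simp_all
    ultimately show False by metis
  qed
qed

lemma circle_arc_meets_frontier:
  assumes "a \<le> b" "(p + \<rho> *\<^sub>R dir a \<in> r) \<noteq> (p + \<rho> *\<^sub>R dir b \<in> r)"
  obtains c where "a \<le> c" "c \<le> b" "p + \<rho> *\<^sub>R dir c \<in> frontier r"
proof -
  let ?f = "\<lambda>t. p + \<rho> *\<^sub>R dir t"
  have "connected (?f ` {a..b})"
    by (intro connected_continuous_image continuous_intros connected_Icc)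
  then have "?f ` {a..b} \<inter> frontier r \<noteq> {}"
  proof (rule connected_Int_frontier)
    have "?f a \<in> ?f ` {a..b}" "?f b \<in> ?f ` {a..b}"
      using assms(1) imageI[of a "{a..b}" ?f] imageI[of b "{a..b}" ?f] by simp_all
    moreover have "?f a \<in> r \<and> ?f b \<notin> r \<or> ?f a \<notin> r \<and> ?f b \<in> r"
      using assms(2) by argo
    ultimately show "?f ` {a..b} \<inter> r \<noteq> {}" "?f ` {a..b} - r \<noteq> {}"
      by (metis Diff_iff IntI empty_iff)+
  qed
  then show ?thesis using that by auto
qed

section \<open>Polygonal paths and the sides of a simple polygon\<close>

lemma polygonal_path_start [simp]: "pathstart (polygonal_path (a # xs)) = a"
  by (cases "a # xs" rule: polygonal_path.cases) auto

lemma polygonal_path_finish [simp]: "xs \<noteq> [] \<Longrightarrow> pathfinish (polygonal_path xs) = last xs"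
  by (induction xs rule: polygonal_path.induct) auto

lemma path_image_polygonal_path:
  "2 \<le> length xs \<Longrightarrow>
    path_image (polygonal_path xs) = (\<Union>i<length xs - 1. closed_segment (xs ! i) (xs ! Suc i))"
proof (induction xs rule: polygonal_path.induct)
  case (4 a b c xs)
  have "{..<length (a # b # c # xs) - 1} = insert 0 (Suc ` {..<length (b # c # xs) - 1})"
    by (auto simp: lessThan_Suc_eq_insert_0)
  then show ?case using 4 by (simp add: path_image_join)
qed auto

lemma set_subset_path_image_polygonal_path: "set xs \<subseteq> path_image (polygonal_path xs)" if "xs \<noteq> []"
  using that by (induction xs rule: polygonal_path.induct) (auto simp: path_image_join)

text \<open>In an arc that starts with the side from \<open>a\<close> to \<open>b\<close>, the
  remaining path meets this side in \<open>b\<close> only, so \<open>a\<close> does not recur;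
  induction repeats this along the list.\<close>

lemma arc_polygonal_path_distinct:
  "2 \<le> length xs \<Longrightarrow> arc (polygonal_path xs) \<Longrightarrow> distinct xs"
proof (induction xs rule: polygonal_path.induct)
  case (3 a b)
  then show ?case using arc_distinct_ends by fastforce
next
  case (4 a b c xs)
  have *: "arc (linepath a b)" "arc (polygonal_path (b # c # xs))"
    "closed_segment a b \<inter> path_image (polygonal_path (b # c # xs)) \<subseteq> {b}"
    using 4(3) by (simp_all add: arc_join_eq)
  have "a \<noteq> b" using *(1) arc_distinct_ends by fastforce
  then have "a \<notin> path_image (polygonal_path (b # c # xs))" using *(3) by auto
  then have "a \<notin> set (b # c # xs)"
    using set_subset_path_image_polygonal_path[of "b # c # xs"] by blast
  then show ?case using 4(1) *(2) by simp
qed auto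

lemma simple_polygon_distinct:
  assumes "simple_polygon vs"
  shows "distinct vs"
proof -
  obtain a b c xs where vs: "vs = a # b # c # xs"
    using assms unfolding simple_polygon_def
    by (metis Suc_le_length_iff numeral_3_eq_3)
  have "simple_path (linepath a b +++ polygonal_path (b # c # xs @ [a]))"
    using assms by (simp add: simple_polygon_def polygon_boundary_def vs)
  \<comment> \<open>Removing the first side opens the loop; the remaining arc passes through all
    corners and ends in \<open>a\<close>.\<close>
  then have "arc (polygonal_path (b # c # xs @ [a]))"
    by (subst (asm) simple_path_join_loop_eq) auto
  then have "distinct (b # c # xs @ [a])"
    by (intro arc_polygonal_path_distinct) auto
  then show ?thesis by (auto simp: vs)
qed

lemma path_image_polygon_boundary:
  assumes "vs \<noteq> []"
  shows "path_image (polygon_boundary vs) =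
    (\<Union>i<length vs. closed_segment (vs ! i) (vs ! (Suc i mod length vs)))"
proof -
  have "path_image (polygon_boundary vs) =
      (\<Union>i<length vs. closed_segment ((vs @ [hd vs]) ! i) ((vs @ [hd vs]) ! Suc i))"
    using assms unfolding polygon_boundary_def
    by (subst path_image_polygonal_path) (auto simp: Suc_le_eq)
  also have "\<dots> = (\<Union>i<length vs. closed_segment (vs ! i) (vs ! (Suc i mod length vs)))"
  proof (rule SUP_cong[OF refl])
    fix i assume i: "i \<in> {..<length vs}"
    show "closed_segment ((vs @ [hd vs]) ! i) ((vs @ [hd vs]) ! Suc i) =
      closed_segment (vs ! i) (vs ! (Suc i mod length vs))"
    proof (cases "Suc i = length vs")
      case True
      then show ?thesis using i assms by (simp add: nth_append hd_conv_nth)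
    next
      case False
      then have "Suc i < length vs" using i by auto
      then show ?thesis by (simp add: nth_append)
    qed
  qed
  finally show ?thesis .
qed

text \<open>Three collinear points never have the same distance from a given point.\<close>
lemma finite_circle_Int_open_segment: "finite {t \<in> {0<..<1}. c + dir (\<phi> + s * t) \<in> open_segment a b}"
  if s: "s = 1 \<or> s = -1" for s :: real
proof -
  let ?g = "\<lambda>t. c + dir (\<phi> + s * t)"
  let ?T = "{t \<in> {0<..<1}. ?g t \<in> open_segment a b}"
  \<comment> \<open>Parameters in the unit interval differ by less than a full turn, so it suffices
    to count points.\<close>
  have inj: "inj_on ?g ?T"
  proof (rule inj_onI)
    fix x y assume xy: "x \<in> ?T" "y \<in> ?T" "?g x = ?g y"
    then have "\<bar>s * x - s * y\<bar> < 1"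
      using s by auto
    then have "\<bar>s * x - s * y\<bar> < 2 * pi"
      using pi_gt3 by linarith
    then have "\<not> \<phi> + s * x < \<phi> + s * y" "\<not> \<phi> + s * y < \<phi> + s * x"
      using xy(3) dir_neq[of "\<phi> + s * x" "\<phi> + s * y"] dir_neq[of "\<phi> + s * y" "\<phi> + s * x"]
      by auto
    then show "x = y" using s by auto
  qed
  have "finite (?g ` ?T)"
  proof (rule ccontr)
    assume "infinite (?g ` ?T)"
    then obtain A where A: "A \<subseteq> ?g ` ?T" "card A = 3"
      using infinite_arbitrarily_large by blast
    then obtain x y z where xyz: "A = {x,y,z}" "x \<noteq> y" "y \<noteq> z" "x \<noteq> z"
      by (auto simp: card_3_iff)
    have d: "dist c x = 1" "dist c y = 1" "dist c z = 1"
      using A(1) xyz by (auto simp: dist_norm)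
    have "A \<subseteq> closed_segment a b" using A(1) segment_open_subset_closed by fastforce
    then have "collinear {x,y,z}"
      using xyz collinear_closed_segment collinear_subset by metis
    then consider "between (y,z) x" | "between (z,x) y" | "between (x,y) z"
      by (auto simp: collinear_between_cases)
    then show False
    proof cases
      case 1
      then have "x \<in> open_segment y z" using xyz by (auto simp: between_mem_segment open_segment_def)
      then show False using dist_decreases_open_segment[of x y z c] d by auto
    next
      case 2
      then have "y \<in> open_segment z x" using xyz by (auto simp: between_mem_segment open_segment_def)
      then show False using dist_decreases_open_segment[of y z x c] d by auto
    next
      case 3
      then have "z \<in> open_segment x y" using xyz by (auto simp: between_mem_segment open_segment_def)
      then show False using dist_decreases_open_segment[of z x y c] d by auto
    qed
  qed
  then show ?thesis using inj finite_imageD by blast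
qed

subsection \<open>Regions near a point\<close>

locale polygon_coloured_plane =
  fixes \<alpha> :: "real^2 \<Rightarrow> 'c" and V :: "(real^2) set" and B R :: "(real^2) set set"
  assumes colouring: "polygon_coloring \<alpha> V B R"
begin

lemma finite_colours: "finite (range \<alpha>)"
  using colouring by (simp add: polygon_coloring_def)

lemma unit_distance: "dist x y = 1 \<Longrightarrow> \<alpha> x \<noteq> \<alpha> y"
  using colouring by (simp add: polygon_coloring_def)

lemma pieces_partition: "partition_on UNIV (R \<union> B \<union> (\<lambda>v. {v}) ` V)"
  using colouring by (simp add: polygon_coloring_def)

lemma pieces_locally_finite: "finite {S \<in> R \<union> B \<union> (\<lambda>v. {v}) ` V. S \<inter> cball x e \<noteq> {}}"
  using colouring by (simp add: polygon_coloring_def locally_finite_family_def)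

lemma border_ends: "b \<in> B \<Longrightarrow> \<exists>u\<in>V. \<exists>w\<in>V. u \<noteq> w \<and> b = open_segment u w"
  using colouring by (simp add: polygon_coloring_def)

lemma region_polygon: "r \<in> R \<Longrightarrow> \<exists>vs. simple_polygon vs \<and> r = open_polygon vs \<and> set vs \<subseteq> V \<and>
    (\<forall>i<length vs. open_segment (vs ! i) (vs ! (Suc i mod length vs)) \<in> B)"
  using colouring by (simp add: polygon_coloring_def)

lemma region_monochromatic: "r \<in> R \<Longrightarrow> x \<in> r \<Longrightarrow> y \<in> r \<Longrightarrow> \<alpha> x = \<alpha> y"
  using colouring unfolding polygon_coloring_def by metis

lemma regions_at_vertex_differ:
  "r \<in> R \<Longrightarrow> s \<in> R \<Longrightarrow> r \<noteq> s \<Longrightarrow> v \<in> V \<Longrightarrow> v \<in> frontier r \<Longrightarrow> v \<in> frontier s \<Longrightarrow>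
    x \<in> r \<Longrightarrow> y \<in> s \<Longrightarrow> \<alpha> x \<noteq> \<alpha> y"
  using colouring unfolding polygon_coloring_def by metis

lemma closed_polygon_boundary: "simple_polygon vs \<Longrightarrow> closed (path_image (polygon_boundary vs))"
  by (simp add: simple_polygon_def closed_simple_path_image)

lemma region_open: "r \<in> R \<Longrightarrow> open r"
  using region_polygon[of r] open_inside closed_polygon_boundary by (auto simp: open_polygon_def)

lemma piece_nonempty: "S \<in> R \<union> B \<union> (\<lambda>v. {v}) ` V \<Longrightarrow> S \<noteq> {}"
  using pieces_partition unfolding partition_on_def by metis

lemma pieces_disjoint: 
  "S \<in> R \<union> B \<union> (\<lambda>v. {v}) ` V \<Longrightarrow> T \<in> R \<union> B \<union> (\<lambda>v. {v}) ` V \<Longrightarrow> S \<noteq> T \<Longrightarrow> S \<inter> T = {}"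
  using pieces_partition unfolding partition_on_def disjoint_def by metis

lemma region_disjoint: "r \<in> R \<Longrightarrow> s \<in> R \<Longrightarrow> r \<noteq> s \<Longrightarrow> r \<inter> s = {}"
  by (rule pieces_disjoint) auto

lemma border_disjoint: "b \<in> B \<Longrightarrow> b' \<in> B \<Longrightarrow> b \<noteq> b' \<Longrightarrow> b \<inter> b' = {}"
  by (rule pieces_disjoint) auto

lemma region_border_disjoint:
  assumes "r \<in> R" "b \<in> B"
  shows "r \<inter> b = {}"
proof (rule pieces_disjoint)
  \<comment> \<open>The partition separates only different pieces. An open region equal to a border
    would be empty, because a segment has empty interior in the plane.\<close>
  show "r \<noteq> b"
  proof
    assume "r = b"
    then have "r = {}"
      using border_ends[OF assms(2)] region_open[OF assms(1)] interior_open[of r]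
      by (auto simp: interior_open_segment)
    then show False using piece_nonempty assms by auto
  qed
qed (use assms in auto)

lemma vertex_notin_region:
  assumes "r \<in> R" "v \<in> V"
  shows "v \<notin> r"
proof -
  have "r \<noteq> {v}" using region_open[OF assms(1)] not_open_singleton by metis
  then have "r \<inter> {v} = {}" using assms by (intro pieces_disjoint) auto
  then show ?thesis by simp
qed

lemma vertex_notin_border:
  assumes "b \<in> B" "v \<in> V"
  shows "v \<notin> b"
proof -
  obtain u w where "b = open_segment u w" "u \<noteq> w" using border_ends assms by metis
  then have "b \<noteq> {v}" by (metis finite.emptyI finite_insert finite_open_segment)
  then have "b \<inter> {v} = {}" using assms by (intro pieces_disjoint) auto
  then show ?thesis by simp
qed

lemma plane_cover: "(\<exists>r\<in>R. x \<in> r) \<or> (\<exists>b\<in>B. x \<in> b) \<or> x \<in> V"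
proof -
  have "x \<in> \<Union>(R \<union> B \<union> (\<lambda>v. {v}) ` V)"
    using pieces_partition by (simp add: partition_on_def)
  then show ?thesis by auto
qed

text \<open>Regions are open and disjoint, so no region contains a limit point of another one or a
  frontier point of its own.\<close>

lemma frontier_region_subset: "r \<in> R \<Longrightarrow> frontier r \<subseteq> \<Union>B \<union> V"
proof
  fix x assume r: "r \<in> R" "x \<in> frontier r"
  have "x \<notin> s" if "s \<in> R" for s
  proof
    assume "x \<in> s"
    have "x \<in> closure r" "x \<notin> r" using r region_open by (auto simp: frontier_def interior_open)
    then have "s \<inter> r \<noteq> {}" "s \<noteq> r"
      using open_Int_closure_eq_empty[of s r] region_open[OF that] \<open>x \<in> s\<close> by auto
    then show False using region_disjoint that r by auto
  qed
  then show "x \<in> \<Union>B \<union> V" using plane_cover[of x] by auto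
qed

text \<open>The corners of the polygon are distinct and no border contains a vertex, so at most two
  sides reach \<open>v\<close>, and both end there.\<close>

lemma thin_at_vertex:
  assumes "r \<in> R" "v \<in> V"
  shows "thin_at (frontier r) v"
proof -
  obtain vs where vs: "simple_polygon vs" "r = open_polygon vs" "set vs \<subseteq> V"
    "\<And>i. i < length vs \<Longrightarrow> open_segment (vs ! i) (vs ! (Suc i mod length vs)) \<in> B"
    using region_polygon[OF assms(1)] by metis
  define n where "n = length vs"
  define seg where "seg = (\<lambda>i. closed_segment (vs ! i) (vs ! (Suc i mod n)))"
  have n: "n \<ge> 3" using vs(1) by (simp add: n_def simple_polygon_def)
  have "distinct vs" using vs(1) by (rule simple_polygon_distinct)
  have "path_image (polygon_boundary vs) = (\<Union>i<n. seg i)"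
    unfolding seg_def n_def using n by (intro path_image_polygon_boundary) (auto simp: n_def)
  moreover have "frontier r \<subseteq> path_image (polygon_boundary vs)"
    unfolding vs(2) open_polygon_def
    by (intro frontier_inside_subset closed_polygon_boundary vs)
  ultimately have fr: "frontier r \<subseteq> (\<Union>i<n. seg i)" by simp
  have seg_v: "v = vs ! i \<or> v = vs ! (Suc i mod n)" if "i < n" "v \<in> seg i" for i
    using that vertex_notin_border[OF vs(4)[of i] assms(2)]
    by (auto simp: seg_def n_def open_segment_def)
  obtain I a b where I: "finite I" "\<And>i. i \<in> I \<Longrightarrow> v \<notin> seg i"
    and cover: "(\<Union>i<n. seg i) \<subseteq> closed_segment v a \<union> closed_segment v b \<union> (\<Union>i\<in>I. seg i)"
  proof (cases "v \<in> set vs")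
    case True
    then obtain k where k: "k < n" "v = vs ! k" by (auto simp: in_set_conv_nth n_def)
    \<comment> \<open>The side \<open>j\<close> precedes \<open>k\<close> in cyclic order; all sides
      other than these two miss \<open>v\<close>.\<close>
    define j where "j = (if k = 0 then n - 1 else k - 1)"
    have j: "j < n" "Suc j mod n = k" using k n by (auto simp: j_def)
    have other: "v \<notin> seg i" if "i \<in> {..<n} - {j,k}" for i
    proof
      assume "v \<in> seg i"
      then have "v = vs ! (Suc i mod n)"
        using seg_v that k \<open>distinct vs\<close> by (auto simp: nth_eq_iff_index_eq n_def)
      moreover have "Suc i mod n < n" using n by simp
      ultimately have "Suc i mod n = k"
        using k \<open>distinct vs\<close> by (simp add: nth_eq_iff_index_eq n_def)
      then have "i = j"
        using that k(1) by (auto simp: j_def mod_Suc split: if_splits)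
      then show False using that by simp
    qed
    have "seg j = closed_segment v (vs ! j)" "seg k = closed_segment v (vs ! (Suc k mod n))"
      using j(2) k(2) by (simp_all add: seg_def closed_segment_commute)
    then have "(\<Union>i<n. seg i) \<subseteq> closed_segment v (vs ! j) \<union> closed_segment v (vs ! (Suc k mod n)) \<union>
        (\<Union>i\<in>{..<n} - {j,k}. seg i)"
      by auto
    then show ?thesis
      using other by (intro that[of "{..<n} - {j,k}"]) auto
  next
    case False
    \<comment> \<open>If \<open>v\<close> is not a corner, no side contains it, and \<open>a\<close>
      and \<open>b\<close> are arbitrary.\<close>
    have "v \<notin> seg i" if "i < n" for i
      using seg_v[OF that] False n that by (metis mod_less_divisor n_def not_less_zero nth_mem gr_zeroI)
    then show ?thesis by (intro that[of "{..<n}"]) auto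
  qed
  define S where "S = (\<Union>i\<in>I. seg i)"
  have S: "closed S" "v \<notin> S"
    using I by (auto simp: S_def seg_def)
  have "frontier r \<inter> ball v 1 \<subseteq> closed_segment v a \<union> closed_segment v b \<union> S"
    using fr cover unfolding S_def by blast
  then show ?thesis
    using S by (intro thin_at_segments) auto
qed

text \<open>Local finiteness leaves finitely many borders and vertices near \<open>p\<close>. At
  most one border contains \<open>p\<close>, which splits it into two segments; the closures of the
  other pieces miss \<open>p\<close>, since closing a border adds only vertices.\<close>

lemma thin_at_border:
  assumes "p \<notin> V"
  shows "thin_at (\<Union>B \<union> V) p"
proof -
  define F where "F = {S \<in> R \<union> B \<union> (\<lambda>v. {v}) ` V. S \<inter> cball p 1 \<noteq> {}}"
  have F: "finite F" unfolding F_def by (rule pieces_locally_finite)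
  define S where "S = (\<Union>T\<in>{T \<in> F. T \<notin> R \<and> p \<notin> T}. closure T)"
  have "closed S" using F by (auto simp: S_def)
  moreover have "p \<notin> S"
  proof
    assume "p \<in> S"
    then obtain T where T: "T \<in> F" "T \<notin> R" "p \<notin> T" "p \<in> closure T" by (auto simp: S_def)
    then consider "T \<in> B" | v where "v \<in> V" "T = {v}" by (auto simp: F_def)
    then show False
    proof cases
      case 1
      then obtain u w where "u \<in> V" "w \<in> V" "T = open_segment u w" "u \<noteq> w"
        using border_ends by metis
      moreover from this have "p \<in> closed_segment u w" using T(4) by simp
      ultimately show False using T(3) assms by (auto simp: open_segment_def)
    next
      case 2
      then show False using T by auto
    qed
  qed
  moreover obtain a b where ab: "\<And>T. T \<in> B \<Longrightarrow> p \<in> T \<Longrightarrow> T \<subseteq> closed_segment p a \<union> closed_segment p b"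
  proof (cases "\<exists>T\<in>B. p \<in> T")
    case True
    then obtain T where T: "T \<in> B" "p \<in> T" by auto
    obtain u w where uw: "T = open_segment u w" "u \<noteq> w" using T border_ends by metis
    then have "T \<subseteq> closed_segment p u \<union> closed_segment p w"
      using T(2) Un_closed_segment[of p u w] by (auto simp: open_segment_def closed_segment_commute)
    then show ?thesis using border_disjoint T by (intro that[of u w]) blast
  qed auto
  moreover have "(\<Union>B \<union> V) \<inter> ball p 1 \<subseteq> closed_segment p a \<union> closed_segment p b \<union> S"
  proof
    fix x assume x: "x \<in> (\<Union>B \<union> V) \<inter> ball p 1"
    obtain T where T: "T \<in> B \<union> (\<lambda>v. {v}) ` V" "x \<in> T" using x by auto
    then have "x \<in> T \<inter> cball p 1" using x by auto
    then have "T \<in> F" using T by (auto simp: F_def)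
    have "T \<notin> R"
      using T vertex_notin_region region_border_disjoint by fastforce
    show "x \<in> closed_segment p a \<union> closed_segment p b \<union> S"
    proof (cases "p \<in> T")
      case True
      then have "T \<in> B" using T assms by auto
      then show ?thesis using ab True T(2) by blast
    next
      case False
      then show ?thesis
        using \<open>T \<in> F\<close> \<open>T \<notin> R\<close> closure_subset[of T] T(2) by (auto simp: S_def)
    qed
  qed
  ultimately show ?thesis
    by (intro thin_at_segments[where e = 1]) auto
qed

section \<open>Colours of regions and of arcs of unit circles\<close>

definition region_colour :: "(real^2) set \<Rightarrow> 'c" where
  "region_colour r = \<alpha> (SOME x. x \<in> r)"

lemma region_colour_eq:
  assumes "r \<in> R" "x \<in> r"
  shows "region_colour r = \<alpha> x"
  unfolding region_colour_def
  by (rule region_monochromatic[OF assms(1) someI assms(2)]) (rule assms(2))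

text \<open>No region contains a vertex, so a vertex in the closure of a region lies on its
  frontier. This allows working with closures throughout.\<close>

lemma region_colour_neq:
  assumes "r \<in> R" "s \<in> R" "r \<noteq> s" "v \<in> V" "v \<in> closure r" "v \<in> closure s"
  shows "region_colour r \<noteq> region_colour s"
proof -
  have "v \<in> frontier r" "v \<in> frontier s"
    using assms vertex_notin_region region_open by (auto simp: frontier_def interior_open)
  moreover obtain x y where xy: "x \<in> r" "y \<in> s"
    using assms(1,2) piece_nonempty[of r] piece_nonempty[of s] by auto
  ultimately have "\<alpha> x \<noteq> \<alpha> y"
    using assms by (intro regions_at_vertex_differ)
  then show ?thesis
    using region_colour_eq[OF assms(1) xy(1)] region_colour_eq[OF assms(2) xy(2)] by simp
qed

definition colours_at :: "real^2 \<Rightarrow> 'c set" where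
  "colours_at p = region_colour ` {r \<in> R. p \<in> closure r}"

lemma colours_at_subset: "colours_at p \<subseteq> range \<alpha>"
  by (auto simp: colours_at_def region_colour_def)

lemma finite_colours_at: "finite (colours_at p)"
  using colours_at_subset finite_colours finite_subset by metis

text \<open>Travelling on the unit circle around \<open>c\<close>, the moment after angle \<open>\<phi>\<close> is spent in \<open>r\<close>;
  \<open>s\<close> is \<open>1\<close> (counterclockwise) or \<open>-1\<close> (clockwise).\<close>
definition arc_enters :: "real^2 \<Rightarrow> real \<Rightarrow> real \<Rightarrow> (real^2) set \<Rightarrow> bool" where
  "arc_enters c \<phi> s r \<longleftrightarrow> r \<in> R \<and> (\<forall>\<^sub>F t in at_right 0. c + dir (\<phi> + s * t) \<in> r)"

text \<open>Finitely many borders and vertices meet the unit disk around \<open>c\<close>, and the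
  arc meets each finitely often. A short initial arc therefore avoids them all and, being connected,
  stays in one of the disjoint open regions.\<close>

lemma arc_enters_exists:
  assumes s: "s = 1 \<or> s = -1"
  obtains r where "arc_enters c \<phi> s r"
proof -
  let ?g = "\<lambda>t. c + dir (\<phi> + s * t)"
  define F where "F = {S \<in> R \<union> B \<union> (\<lambda>v. {v}) ` V. S \<inter> cball c 1 \<noteq> {}}"
  have F: "finite F" unfolding F_def by (rule pieces_locally_finite)
  have "finite {t \<in> {0<..<1}. ?g t \<in> S}" if "S \<in> F - R" for S
  proof -
    have "S \<in> B \<or> (\<exists>v. S = {v})" using that by (auto simp: F_def)
    then consider "S \<in> B" | v where "S = {v}" by blast
    then show ?thesis
    proof cases
      case 1
      then show ?thesis
        using border_ends[of S] finite_circle_Int_open_segment[OF s] by auto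
    next
      case 2
      have "{t \<in> {0<..<1}. ?g t \<in> S} \<subseteq> {t \<in> {0<..<1}. ?g t \<in> {v}}" using 2 by auto
      moreover have "finite {t \<in> {0<..<1}. ?g t \<in> {v}}"
      proof (rule finite_subset)
        \<comment> \<open>A point is the midpoint of a proper segment, so the bound for segments
          covers vertices too.\<close>
        define e where "e = dir 0"
        have "v - e \<noteq> v + e"
          using dir_nonzero[of 0] by (auto simp: e_def vec_eq_iff forall_2)
        then have "midpoint (v - e) (v + e) \<in> open_segment (v - e) (v + e)"
          by (rule iffD2[OF midpoint_in_open_segment])
        moreover have "midpoint (v - e) (v + e) = v"
          by (simp add: midpoint_def vec_eq_iff)
        ultimately have "v \<in> open_segment (v - e) (v + e)" by simp
        then show "{t \<in> {0<..<1}. ?g t \<in> {v}} \<subseteq> {t \<in> {0<..<1}. ?g t \<in> open_segment (v - e) (v + e)}"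
          by auto
      qed (rule finite_circle_Int_open_segment[OF s])
      ultimately show ?thesis by (rule finite_subset)
    qed
  qed
  then have "finite (\<Union>S\<in>F - R. {t \<in> {0<..<1}. ?g t \<in> S})" (is "finite ?T")
    using F by (intro finite_UN_I) auto
  from finite_set_avoid[OF this, of 0] obtain d
    where d: "d > 0" "\<forall>t\<in>?T. t \<noteq> 0 \<longrightarrow> d \<le> dist 0 t"
    by auto
  define e where "e = min d 1"
  have "e > 0" using d(1) by (simp add: e_def)
  have inR: "?g t \<in> \<Union>R" if "0 < t" "t < e" for t
  proof (rule ccontr)
    assume "?g t \<notin> \<Union>R"
    then obtain S where S: "S \<in> B \<union> (\<lambda>v. {v}) ` V" "?g t \<in> S"
      using plane_cover[of "?g t"] by auto
    moreover from this have "S \<notin> R" using \<open>?g t \<notin> \<Union>R\<close> by auto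
    moreover have "?g t \<in> cball c 1" by (simp add: dist_norm)
    ultimately have "S \<in> F - R" by (auto simp: F_def)
    moreover have "t \<in> {0<..<1}" using that by (simp add: e_def)
    ultimately have "t \<in> ?T" using S(2) by blast
    then have "d \<le> t" using bspec[OF d(2), of t] that by simp
    then show False using that by (simp add: e_def)
  qed
  obtain r where r: "r \<in> R" "?g (e/2) \<in> r" using inR[of "e/2"] \<open>e > 0\<close> by auto
  have "connected (?g ` {0<..<e})"
    by (intro connected_continuous_image continuous_intros connected_Ioo)
  moreover have "open r" "open (\<Union>(R - {r}))" using r region_open by (auto intro!: open_Union)
  moreover have "r \<inter> \<Union>(R - {r}) \<inter> ?g ` {0<..<e} = {}" using region_disjoint r by blast
  moreover have "?g ` {0<..<e} \<subseteq> r \<union> \<Union>(R - {r})" using inR by fastforce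
  ultimately have "r \<inter> ?g ` {0<..<e} = {} \<or> \<Union>(R - {r}) \<inter> ?g ` {0<..<e} = {}"
    by (rule connectedD)
  moreover have "?g (e/2) \<in> ?g ` {0<..<e}" using \<open>e > 0\<close> by (intro imageI) auto
  ultimately have "\<Union>(R - {r}) \<inter> ?g ` {0<..<e} = {}" using r by blast
  then have "?g t \<in> r" if "0 < t" "t < e" for t using inR[OF that] that by fastforce
  then have "\<forall>\<^sub>F t in at_right 0. ?g t \<in> r"
    using \<open>e > 0\<close> by (auto simp: eventually_at_right_field)
  then show ?thesis using that r(1) by (simp add: arc_enters_def)
qed

lemma arc_enters_unique:
  assumes "arc_enters c \<phi> s r" "arc_enters c \<phi> s r'"
  shows "r = r'"
proof -
  have "\<forall>\<^sub>F t in at_right 0. c + dir (\<phi> + s * t) \<in> r \<inter> r'"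
    using assms by (auto simp: arc_enters_def eventually_conj_iff)
  then have "\<exists>t. c + dir (\<phi> + s * t) \<in> r \<inter> r'"
    using eventually_happens trivial_limit_at_right_real by blast
  then show ?thesis using region_disjoint assms by (auto simp: arc_enters_def)
qed

definition arc_region :: "real^2 \<Rightarrow> real \<Rightarrow> real \<Rightarrow> (real^2) set" where
  "arc_region c \<phi> s = (SOME r. arc_enters c \<phi> s r)"

definition arc_colour :: "real^2 \<Rightarrow> real \<Rightarrow> real \<Rightarrow> 'c" where
  "arc_colour c \<phi> s = region_colour (arc_region c \<phi> s)"

lemma arc_enters_region: "s = 1 \<or> s = -1 \<Longrightarrow> arc_enters c \<phi> s (arc_region c \<phi> s)"
  unfolding arc_region_def using arc_enters_exists by (metis someI_ex)

lemma arc_region_in: "s = 1 \<or> s = -1 \<Longrightarrow> arc_region c \<phi> s \<in> R"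
  using arc_enters_region by (auto simp: arc_enters_def)

lemma arc_region_eqI: "arc_enters c \<phi> s r \<Longrightarrow> s = 1 \<or> s = -1 \<Longrightarrow> arc_region c \<phi> s = r"
  using arc_enters_region arc_enters_unique by metis

lemma closure_arc_region:
  assumes s: "s = 1 \<or> s = -1"
  shows "c + dir \<phi> \<in> closure (arc_region c \<phi> s)"
proof -
  let ?g = "\<lambda>t. c + dir (\<phi> + s * t)"
  have "continuous_on UNIV ?g" by (intro continuous_intros)
  then have "(?g \<longlongrightarrow> ?g 0) (at 0)"
    unfolding continuous_on_def by blast
  then have "(?g \<longlongrightarrow> ?g 0) (at_right 0)"
    by (rule tendsto_within_subset) auto
  moreover have "\<forall>\<^sub>F t in at_right 0. ?g t \<in> arc_region c \<phi> s"
    using arc_enters_region[OF s] by (simp add: arc_enters_def)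
  then have "\<forall>\<^sub>F t in at_right 0. ?g t \<in> closure (arc_region c \<phi> s)"
    by (rule eventually_mono) (use closure_subset in blast)
  ultimately have "?g 0 \<in> closure (arc_region c \<phi> s)"
    by (intro Lim_in_closed_set) (auto simp: trivial_limit_at_right_real)
  then show ?thesis by simp
qed

lemma arc_colour_in_range: "s = 1 \<or> s = -1 \<Longrightarrow> arc_colour c \<phi> s \<in> range \<alpha>"
  by (simp add: arc_colour_def region_colour_def)

lemma arc_colour_in_colours_at: "s = 1 \<or> s = -1 \<Longrightarrow> arc_colour c \<phi> s \<in> colours_at (c + dir \<phi>)"
  unfolding arc_colour_def colours_at_def using arc_region_in closure_arc_region by blast

text \<open>Translation by \<open>dir \<theta>\<close> takes a point of \<open>r'\<close> near
  \<open>c\<close> to a point near the arc, still inside the open region \<open>r\<close>. The two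
  points have unit distance, so the regions differ in colour.\<close>

lemma arc_colour_notin_colours_at:
  assumes s: "s = 1 \<or> s = -1"
  shows "arc_colour c \<phi> s \<notin> colours_at c"
proof
  assume "arc_colour c \<phi> s \<in> colours_at c"
  then obtain r' where r': "r' \<in> R" "c \<in> closure r'" "arc_colour c \<phi> s = region_colour r'"
    by (auto simp: colours_at_def)
  define r where "r = arc_region c \<phi> s"
  have "r \<in> R" using s by (simp add: r_def arc_region_in)
  have "\<forall>\<^sub>F t in at_right 0. c + dir (\<phi> + s * t) \<in> r"
    using arc_enters_region[OF s] by (auto simp: r_def arc_enters_def)
  then obtain \<theta> where q: "c + dir \<theta> \<in> r"
    using eventually_happens trivial_limit_at_right_real by blast
  then obtain e where e: "e > 0" "ball (c + dir \<theta>) e \<subseteq> r"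
    using region_open[OF \<open>r \<in> R\<close>] open_contains_ball by metis
  obtain c' where c': "c' \<in> r'" "dist c' c < e"
    using r'(2) e(1) by (auto simp: closure_approachable)
  have "c' + dir \<theta> \<in> r"
    using e(2) c'(2) by (auto simp: dist_norm norm_minus_commute subset_iff)
  moreover have "dist (c' + dir \<theta>) c' = 1" by (simp add: dist_norm)
  ultimately have "region_colour r \<noteq> region_colour r'"
    using unit_distance region_colour_eq \<open>r \<in> R\<close> r'(1) c'(1) by metis
  then show False using r'(3) by (simp add: arc_colour_def r_def)
qed

text \<open>Two points that run along the circle sixty degrees apart stay at unit distance, and for
  short times each lies in its own region.\<close>

lemma arc_colour_sixty:
  assumes s: "s = 1 \<or> s = -1"
  shows "arc_colour c (\<phi> + pi/3) s \<noteq> arc_colour c \<phi> s"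
proof -
  let ?r = "arc_region c \<phi> s" and ?r' = "arc_region c (\<phi> + pi/3) s"
  have "\<forall>\<^sub>F t in at_right 0. c + dir (\<phi> + s * t) \<in> ?r \<and> c + dir (\<phi> + pi/3 + s * t) \<in> ?r'"
    using arc_enters_region[OF s] by (auto simp: arc_enters_def eventually_conj_iff)
  then obtain t where t: "c + dir (\<phi> + s * t) \<in> ?r" "c + dir (\<phi> + pi/3 + s * t) \<in> ?r'"
    using eventually_happens trivial_limit_at_right_real by blast
  have "dist (c + dir (\<phi> + pi/3 + s * t)) (c + dir (\<phi> + s * t)) = 1"
    using norm_dir_diff_sixty[of "\<phi> + s * t"] by (simp add: dist_norm add_ac)
  then show ?thesis
    unfolding arc_colour_def
    using t unit_distance region_colour_eq arc_region_in[OF s] by metis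
qed

section \<open>Arcs seen from a common initial point\<close>

text \<open>The same arc in polar coordinates around its initial point; its initial direction is \<open>\<psi>\<close>.\<close>
definition ray_enters :: "real^2 \<Rightarrow> real \<Rightarrow> real \<Rightarrow> (real^2) set \<Rightarrow> bool" where
  "ray_enters p \<psi> s r \<longleftrightarrow> r \<in> R \<and> (\<forall>\<^sub>F \<tau> in at_right 0. p + (2 * sin \<tau>) *\<^sub>R dir (\<psi> + s * \<tau>) \<in> r)"

lemma ray_enters_arc_region:
  assumes s: "s = 1 \<or> s = -1" and "p = c + dir \<phi>" "\<psi> = \<phi> + s * (pi/2)"
  shows "ray_enters p \<psi> s (arc_region c \<phi> s)"
proof -
  have "\<forall>\<^sub>F t in at_right 0. c + dir (\<phi> + s * t) \<in> arc_region c \<phi> s"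
    using arc_enters_region[OF s] by (simp add: arc_enters_def)
  then obtain b where b: "b > 0" "\<And>t. 0 < t \<Longrightarrow> t < b \<Longrightarrow> c + dir (\<phi> + s * t) \<in> arc_region c \<phi> s"
    by (auto simp: eventually_at_right_field)
  \<comment> \<open>The bound is halved because the central angle is
    \<open>2 * \<tau>\<close>.\<close>
  have "p + (2 * sin \<tau>) *\<^sub>R dir (\<psi> + s * \<tau>) \<in> arc_region c \<phi> s" if "0 < \<tau>" "\<tau> < b/2" for \<tau>
    using b(2)[of "2 * \<tau>"] that dir_chord[OF s, of \<phi> \<tau>] assms(2,3) by (simp add: add_ac)
  then show ?thesis
    using b(1) arc_region_in[OF s] unfolding ray_enters_def eventually_at_right_field
    by (intro conjI exI[of _ "b/2"]) auto
qed

text \<open>The unit circle with centre \<open>p - dir (\<psi> - pi/2)\<close>, run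
  counterclockwise, passes through \<open>p\<close> in direction \<open>\<psi>\<close>.\<close>

lemma ray_enters_exists:
  obtains r where "ray_enters p \<psi> 1 r" "p \<in> closure r"
proof -
  define c where "c = p - dir (\<psi> - pi/2)"
  have "ray_enters p \<psi> 1 (arc_region c (\<psi> - pi/2) 1)"
    by (intro ray_enters_arc_region) (auto simp: c_def)
  moreover have "p \<in> closure (arc_region c (\<psi> - pi/2) 1)"
    using closure_arc_region[of 1 c "\<psi> - pi/2"] by (simp add: c_def)
  ultimately show ?thesis using that by blast
qed

lemma ray_enters_add_2pi: "ray_enters p (\<psi> + 2 * pi) s r \<longleftrightarrow> ray_enters p \<psi> s r"
proof -
  have "dir (\<psi> + 2 * pi + s * \<tau>) = dir (\<psi> + s * \<tau>)" for \<tau>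
    using dir_add_2pi[of "\<psi> + s * \<tau>"] by (simp add: add_ac)
  then show ?thesis by (simp add: ray_enters_def)
qed

text \<open>Curved rays with different initial directions keep their angular order for short times,
  whichever way they bend.\<close>

lemma eventually_angle_less: "\<psi> < \<psi>' \<Longrightarrow> \<forall>\<^sub>F \<tau> in at_right 0. \<psi> + s * \<tau> < \<psi>' + s' * (\<tau>::real)" for \<psi> :: real
proof -
  assume "\<psi> < \<psi>'"
  moreover have "((\<lambda>\<tau>. (\<psi>' + s' * \<tau>) - (\<psi> + s * \<tau>)) \<longlongrightarrow> (\<psi>' + s' * 0) - (\<psi> + s * 0)) (at_right 0)"
    by (intro tendsto_intros)
  ultimately have "\<forall>\<^sub>F \<tau> in at_right 0. 0 < (\<psi>' + s' * \<tau>) - (\<psi> + s * \<tau>)"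
    by (intro order_tendstoD(1)) auto
  then show ?thesis by (rule eventually_mono) simp
qed

lemma eventually_small_radius: "\<delta> > 0 \<Longrightarrow> \<forall>\<^sub>F \<tau> in at_right 0. 0 < 2 * sin \<tau> \<and> 2 * sin \<tau> < \<delta>" for \<delta> :: real
proof -
  assume "\<delta> > 0"
  have "2 * sin \<tau> < \<delta> \<and> 0 < 2 * sin \<tau>" if "0 < \<tau>" "\<tau> < min (\<delta>/2) 1" for \<tau>
    using sin_x_le_x[of \<tau>] sin_gt_zero[of \<tau>] pi_gt3 that by auto
  then show ?thesis
    using \<open>\<delta> > 0\<close> by (auto simp: eventually_at_right_field intro!: exI[of _ "min (\<delta>/2) 1"])
qed

lemma notin_frontier_region:
  assumes "r \<in> R" "x \<in> r" "s \<in> R"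
  shows "x \<notin> frontier s"
  using frontier_region_subset[OF assms(3)] vertex_notin_region[OF assms(1)]
    region_border_disjoint[OF assms(1)] assms(2) by blast

text \<open>Each of the three arcs between consecutive directions contains a frontier point of \<open>r\<^sub>1\<close> or
  \<open>r\<^sub>3\<close>, while \<open>P\<close> meets small circles in at most two points.\<close>
lemma no_four_rays:
  assumes "thin_at P p" "frontier r\<^sub>1 \<subseteq> P" "frontier r\<^sub>3 \<subseteq> P"
    and rays: "ray_enters p \<psi>\<^sub>1 s\<^sub>1 r\<^sub>1" "ray_enters p \<psi>\<^sub>2 s\<^sub>2 r\<^sub>2" "ray_enters p \<psi>\<^sub>3 s\<^sub>3 r\<^sub>3" "ray_enters p \<psi>\<^sub>4 s\<^sub>4 r\<^sub>4"
    and angles: "\<psi>\<^sub>1 < \<psi>\<^sub>2" "\<psi>\<^sub>2 < \<psi>\<^sub>3" "\<psi>\<^sub>3 < \<psi>\<^sub>4" "\<psi>\<^sub>4 < \<psi>\<^sub>1 + 2 * pi"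
    and neq: "r\<^sub>1 \<noteq> r\<^sub>2" "r\<^sub>2 \<noteq> r\<^sub>3" "r\<^sub>3 \<noteq> r\<^sub>4"
  shows False
proof -
  obtain \<delta> where \<delta>: "\<delta> > 0"
    "\<forall>\<rho> x y z. 0 < \<rho> \<and> \<rho> < \<delta> \<and> x < y \<and> y < z \<and> z < x + 2 * pi \<and>
      p + \<rho> *\<^sub>R dir x \<in> P \<and> p + \<rho> *\<^sub>R dir y \<in> P \<longrightarrow> p + \<rho> *\<^sub>R dir z \<notin> P"
    using thin_atD[OF assms(1)] by metis
  let ?q = "\<lambda>\<rho> \<psi>. p + \<rho> *\<^sub>R dir \<psi>"
  \<comment> \<open>For a common \<open>\<tau>\<close> the four points lie on one circle around
    \<open>p\<close>, of radius \<open>2 * sin \<tau>\<close>; this is the purpose of the chord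
    parametrisation.\<close>
  have "\<forall>\<^sub>F \<tau> in at_right 0. (0 < 2 * sin \<tau> \<and> 2 * sin \<tau> < \<delta>) \<and>
      (\<psi>\<^sub>1 + s\<^sub>1 * \<tau> < \<psi>\<^sub>2 + s\<^sub>2 * \<tau> \<and> \<psi>\<^sub>2 + s\<^sub>2 * \<tau> < \<psi>\<^sub>3 + s\<^sub>3 * \<tau> \<and> \<psi>\<^sub>3 + s\<^sub>3 * \<tau> < \<psi>\<^sub>4 + s\<^sub>4 * \<tau> \<and>
       \<psi>\<^sub>4 + s\<^sub>4 * \<tau> < (\<psi>\<^sub>1 + 2 * pi) + s\<^sub>1 * \<tau>) \<and>
      ?q (2 * sin \<tau>) (\<psi>\<^sub>1 + s\<^sub>1 * \<tau>) \<in> r\<^sub>1 \<and> ?q (2 * sin \<tau>) (\<psi>\<^sub>2 + s\<^sub>2 * \<tau>) \<in> r\<^sub>2 \<and>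
      ?q (2 * sin \<tau>) (\<psi>\<^sub>3 + s\<^sub>3 * \<tau>) \<in> r\<^sub>3 \<and> ?q (2 * sin \<tau>) (\<psi>\<^sub>4 + s\<^sub>4 * \<tau>) \<in> r\<^sub>4"
    (is "eventually ?Q _")
    using rays angles by (intro eventually_conj eventually_angle_less eventually_small_radius[OF \<delta>(1)])
      (simp_all add: ray_enters_def)
  from eventually_happens'[OF trivial_limit_at_right_real this] obtain \<tau> where \<tau>: "?Q \<tau>" ..
  obtain \<rho> a b c d where \<rho>: "0 < \<rho>" "\<rho> < \<delta>" and ang: "a < b" "b < c" "c < d" "d < a + 2 * pi"
    and q: "?q \<rho> a \<in> r\<^sub>1" "?q \<rho> b \<in> r\<^sub>2" "?q \<rho> c \<in> r\<^sub>3" "?q \<rho> d \<in> r\<^sub>4"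
    by (rule that[of "2 * sin \<tau>" "\<psi>\<^sub>1 + s\<^sub>1 * \<tau>" "\<psi>\<^sub>2 + s\<^sub>2 * \<tau>" "\<psi>\<^sub>3 + s\<^sub>3 * \<tau>" "\<psi>\<^sub>4 + s\<^sub>4 * \<tau>"]) (use \<tau> in auto)
  have R: "r\<^sub>1 \<in> R" "r\<^sub>2 \<in> R" "r\<^sub>3 \<in> R" "r\<^sub>4 \<in> R" using rays by (auto simp: ray_enters_def)
  have out: "?q \<rho> b \<notin> r\<^sub>1" "?q \<rho> b \<notin> r\<^sub>3" "?q \<rho> d \<notin> r\<^sub>3"
    using q region_disjoint R neq by blast+
  obtain x where x: "a \<le> x" "x \<le> b" "?q \<rho> x \<in> frontier r\<^sub>1"
    using circle_arc_meets_frontier[of a b p \<rho> r\<^sub>1] ang q out by auto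
  obtain y where y: "b \<le> y" "y \<le> c" "?q \<rho> y \<in> frontier r\<^sub>3"
    using circle_arc_meets_frontier[of b c p \<rho> r\<^sub>3] ang q out by auto
  obtain z where z: "c \<le> z" "z \<le> d" "?q \<rho> z \<in> frontier r\<^sub>3"
    using circle_arc_meets_frontier[of c d p \<rho> r\<^sub>3] ang q out by auto
  \<comment> \<open>Neighbouring arcs share an end, but points inside a region lie on no frontier;
    so the three frontier points are distinct.\<close>
  have "x \<noteq> b" "y \<noteq> c"
    using notin_frontier_region q R x(3) y(3) by blast+
  then have "x < y" "y < z" "z < x + 2 * pi" using x y z ang by auto
  then show False using \<delta>(2) \<rho> x(3) y(3) z(3) assms(2,3) by (meson subsetD)
qed

text \<open>If \<open>r\<close> entered both sectors, a small circle would cross its frontier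
  between \<open>\<theta>\<close> and \<open>m\<close>, between \<open>\<eta>\<close> and
  \<open>n\<close>, and between \<open>n\<close> and \<open>\<eta>'\<close>: three points within
  less than a turn, against \<open>thin_at_vertex\<close>.\<close>

lemma ray_not_between_borders:
  assumes "r \<in> R" "v \<in> V"
    and angles: "\<theta> < m" "m < \<theta>'" "\<theta>' \<le> \<eta>" "\<eta> < n" "n < \<eta>'" "\<eta>' < \<theta> + 2 * pi"
    and rays: "ray_enters v m s r" "ray_enters v n s' r"
    and out: "\<And>x. x \<in> {\<theta>, \<eta>, \<eta>'} \<Longrightarrow> \<forall>\<^sub>F \<tau> in at_right 0. v + (2 * sin \<tau>) *\<^sub>R dir x \<notin> r"
  shows False
proof -
  obtain \<delta> where \<delta>: "\<delta> > 0"
    "\<forall>\<rho> x y z. 0 < \<rho> \<and> \<rho> < \<delta> \<and> x < y \<and> y < z \<and> z < x + 2 * pi \<and>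
      v + \<rho> *\<^sub>R dir x \<in> frontier r \<and> v + \<rho> *\<^sub>R dir y \<in> frontier r \<longrightarrow> v + \<rho> *\<^sub>R dir z \<notin> frontier r"
    using thin_atD[OF thin_at_vertex[OF assms(1,2)]] by metis
  let ?q = "\<lambda>\<rho> \<psi>. v + \<rho> *\<^sub>R dir \<psi>"
  \<comment> \<open>The coefficients \<open>0\<close> bring straight rays into the form of
    \<open>eventually_angle_less\<close>.\<close>
  have "\<forall>\<^sub>F \<tau> in at_right 0. (0 < 2 * sin \<tau> \<and> 2 * sin \<tau> < \<delta>) \<and>
      (\<theta> + 0 * \<tau> < m + s * \<tau> \<and> m + s * \<tau> < \<theta>' + 0 * \<tau> \<and> \<eta> + 0 * \<tau> < n + s' * \<tau> \<and> n + s' * \<tau> < \<eta>' + 0 * \<tau>) \<and>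
      ?q (2 * sin \<tau>) (m + s * \<tau>) \<in> r \<and> ?q (2 * sin \<tau>) (n + s' * \<tau>) \<in> r \<and>
      ?q (2 * sin \<tau>) \<theta> \<notin> r \<and> ?q (2 * sin \<tau>) \<eta> \<notin> r \<and> ?q (2 * sin \<tau>) \<eta>' \<notin> r"
    (is "eventually ?Q _")
    using rays angles out by (intro eventually_conj eventually_angle_less eventually_small_radius[OF \<delta>(1)])
      (simp_all add: ray_enters_def)
  from eventually_happens'[OF trivial_limit_at_right_real this] obtain \<tau> where \<tau>: "?Q \<tau>" ..
  obtain \<rho> a b where \<rho>: "0 < \<rho>" "\<rho> < \<delta>" and ang: "\<theta> < a" "a < \<theta>'" "\<eta> < b" "b < \<eta>'"
    and q: "?q \<rho> a \<in> r" "?q \<rho> b \<in> r" "?q \<rho> \<theta> \<notin> r" "?q \<rho> \<eta> \<notin> r" "?q \<rho> \<eta>' \<notin> r"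
    by (rule that[of "2 * sin \<tau>" "m + s * \<tau>" "n + s' * \<tau>"]) (use \<tau> in auto)
  obtain x where x: "\<theta> \<le> x" "x \<le> a" "?q \<rho> x \<in> frontier r"
    using circle_arc_meets_frontier[of \<theta> a v \<rho> r] ang q by auto
  obtain y where y: "\<eta> \<le> y" "y \<le> b" "?q \<rho> y \<in> frontier r"
    using circle_arc_meets_frontier[of \<eta> b v \<rho> r] ang q by auto
  obtain z where z: "b \<le> z" "z \<le> \<eta>'" "?q \<rho> z \<in> frontier r"
    using circle_arc_meets_frontier[of b \<eta>' v \<rho> r] ang q by auto
  have "y \<noteq> b" using notin_frontier_region[OF assms(1) q(2) assms(1)] y(3) by blast
  then have "x < y" "y < z" "z < x + 2 * pi" using x y z ang angles by auto
  then show False using \<delta>(2) \<rho> x(3) y(3) z(3) by metis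
qed

end

section \<open>Four colours at a vertex of degree at least four\<close>

lemma card_4_sorted:
  fixes A :: "real set"
  assumes "card A = 4"
  obtains a b c d where "a \<in> A" "b \<in> A" "c \<in> A" "d \<in> A" "a < b" "b < c" "c < d"
proof -
  have "finite A" using assms by (metis card.infinite zero_neq_numeral)
  then obtain xs where xs: "length xs = 4" "set xs = A" "sorted_wrt (<) xs"
    using assms that by (metis length_sorted_list_of_set set_sorted_list_of_set strict_sorted_list_of_set)
  then obtain a b c d where "xs = [a, b, c, d]"
    by (auto simp: length_Suc_conv eval_nat_numeral)
  then have "A = {a, b, c, d}" "a < b" "b < c" "c < d" using xs by auto
  then show ?thesis by (intro that[of a b c d]) auto
qed

lemma card_ge_4:
  assumes "finite A" "a \<in> A" "b \<in> A" "c \<in> A" "d \<in> A" "distinct [a, b, c, d]"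
  shows "card A \<ge> 4"
proof -
  have "card {a, b, c, d} = 4" using assms(6) by simp
  then show ?thesis using card_mono[OF assms(1), of "{a, b, c, d}"] assms(2-5) by simp
qed

context polygon_coloured_plane
begin

text \<open>Normalising the angle to one turn allows the borders at \<open>v\<close> to be
  sorted.\<close>

lemma border_direction:
  assumes "connected_to b v"
  shows "\<exists>\<theta> \<delta>. 0 \<le> \<theta> \<and> \<theta> < 2 * pi \<and> \<delta> > 0 \<and> (\<forall>\<rho>. 0 < \<rho> \<and> \<rho> < \<delta> \<longrightarrow> v + \<rho> *\<^sub>R dir \<theta> \<in> b)"
proof -
  obtain w where w: "w \<noteq> v" "b = open_segment v w" using assms by (auto simp: connected_to_def)
  define d where "d = norm (w - v)"
  have "d > 0" using w by (simp add: d_def)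
  have "norm ((w - v) /\<^sub>R d) = 1" using \<open>d > 0\<close> by (simp add: d_def)
  then obtain \<theta> where \<theta>: "0 \<le> \<theta>" "\<theta> < 2 * pi" "(w - v) /\<^sub>R d = dir \<theta>"
    using exists_dir by metis
  have wv: "w = v + d *\<^sub>R dir \<theta>" using \<open>d > 0\<close> by (simp flip: \<theta>(3))
  have "v + \<rho> *\<^sub>R dir \<theta> \<in> b" if "0 < \<rho>" "\<rho> < d" for \<rho>
    unfolding w(2) in_segment
    using w(1) that by (intro conjI exI[of _ "\<rho>/d"]) (auto simp: wv algebra_simps)
  then show ?thesis using \<theta> \<open>d > 0\<close> by (intro exI[of _ \<theta>] exI[of _ d]) simp
qed

text \<open>Four borders sorted by angle bound four sectors. A ray into each sector enters a region;
  these regions are pairwise different, and different regions at a vertex have different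
  colours.\<close>

lemma card_colours_at_vertex:
  assumes "v \<in> V" "vertex_degree B v \<ge> 4"
  shows "card (colours_at v) \<ge> 4"
proof -
  obtain X where X: "X \<subseteq> {b \<in> B. connected_to b v}" "card X = 4"
    using obtain_subset_with_card_n[OF assms(2)[unfolded vertex_degree_def]] by metis
  have "\<forall>b\<in>X. \<exists>\<theta> \<delta>. 0 \<le> \<theta> \<and> \<theta> < 2 * pi \<and> \<delta> > 0 \<and> (\<forall>\<rho>. 0 < \<rho> \<and> \<rho> < \<delta> \<longrightarrow> v + \<rho> *\<^sub>R dir \<theta> \<in> b)"
    using X(1) by (intro ballI border_direction) auto
  from bchoice[OF this] obtain \<theta> where "\<forall>b\<in>X. \<exists>\<delta>. 0 \<le> \<theta> b \<and> \<theta> b < 2 * pi \<and> \<delta> > 0 \<and>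
      (\<forall>\<rho>. 0 < \<rho> \<and> \<rho> < \<delta> \<longrightarrow> v + \<rho> *\<^sub>R dir (\<theta> b) \<in> b)" ..
  from bchoice[OF this] obtain \<delta> where "\<forall>b\<in>X. 0 \<le> \<theta> b \<and> \<theta> b < 2 * pi \<and> \<delta> b > 0 \<and>
      (\<forall>\<rho>. 0 < \<rho> \<and> \<rho> < \<delta> b \<longrightarrow> v + \<rho> *\<^sub>R dir (\<theta> b) \<in> b)" ..
  note \<theta> = bspec[OF this]
  \<comment> \<open>Borders that leave \<open>v\<close> in the same direction share points, so they
    coincide.\<close>
  have "inj_on \<theta> X"
  proof (rule inj_onI)
    fix b b' assume b: "b \<in> X" "b' \<in> X" "\<theta> b = \<theta> b'"
    define \<rho> where "\<rho> = min (\<delta> b) (\<delta> b') / 2"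
    have "0 < \<rho>" "\<rho> < \<delta> b" "\<rho> < \<delta> b'" using \<theta>[OF b(1)] \<theta>[OF b(2)] by (auto simp: \<rho>_def min_def)
    then have "v + \<rho> *\<^sub>R dir (\<theta> b) \<in> b" "v + \<rho> *\<^sub>R dir (\<theta> b) \<in> b'"
      using \<theta>[OF b(1)] \<theta>[OF b(2)] b(3) by auto
    then show "b = b'" using border_disjoint[of b b'] b X(1) by auto
  qed
  then have "card (\<theta> ` X) = 4" using X(2) by (simp add: card_image)
  then obtain t\<^sub>0 t\<^sub>1 t\<^sub>2 t\<^sub>3 where t: "t\<^sub>0 \<in> \<theta> ` X" "t\<^sub>1 \<in> \<theta> ` X" "t\<^sub>2 \<in> \<theta> ` X" "t\<^sub>3 \<in> \<theta> ` X"
    "t\<^sub>0 < t\<^sub>1" "t\<^sub>1 < t\<^sub>2" "t\<^sub>2 < t\<^sub>3"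
    by (rule card_4_sorted)
  have "0 \<le> x \<and> x < 2 * pi" if "x \<in> \<theta> ` X" for x
    using \<theta> that by auto
  from this[OF t(1)] this[OF t(4)] have t3: "t\<^sub>3 < t\<^sub>0 + 2 * pi" by linarith
  have out: "\<forall>\<^sub>F \<tau> in at_right 0. v + (2 * sin \<tau>) *\<^sub>R dir t \<notin> r" if r: "r \<in> R" and t: "t \<in> \<theta> ` X" for t r
  proof -
    obtain b where b: "b \<in> X" "t = \<theta> b" using t by auto
    have "b \<in> B" using b X by auto
    have "\<forall>\<^sub>F \<tau> in at_right 0. 0 < 2 * sin \<tau> \<and> 2 * sin \<tau> < \<delta> b"
      using \<theta>[OF b(1)] by (intro eventually_small_radius) auto
    then show ?thesis
    proof (rule eventually_mono)
      fix \<tau> assume "0 < 2 * sin \<tau> \<and> 2 * sin \<tau> < \<delta> b"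
      then have "v + (2 * sin \<tau>) *\<^sub>R dir t \<in> b" using \<theta>[OF b(1)] b(2) by auto
      then show "v + (2 * sin \<tau>) *\<^sub>R dir t \<notin> r"
        using region_border_disjoint[OF r \<open>b \<in> B\<close>] by blast
    qed
  qed
  \<comment> \<open>Angles of a second turn are added so that the last sector can be compared with
    the first one.\<close>
  define T where "T = \<theta> ` X \<union> (\<lambda>t. t + 2 * pi) ` \<theta> ` X"
  have out_T: "\<forall>\<^sub>F \<tau> in at_right 0. v + (2 * sin \<tau>) *\<^sub>R dir t \<notin> r" if "r \<in> R" "t \<in> T" for t r
    using that(2) out[OF that(1)] unfolding T_def by auto
  have T: "t\<^sub>0 \<in> T" "t\<^sub>1 \<in> T" "t\<^sub>2 \<in> T" "t\<^sub>3 \<in> T" "t\<^sub>0 + 2 * pi \<in> T" "t\<^sub>1 + 2 * pi \<in> T"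
    using t(1-4) unfolding T_def by (blast intro: imageI)+
  have sep: "r \<noteq> r'"
    if rays: "ray_enters v m 1 r" "ray_enters v n 1 r'" and "a \<in> T" "b \<in> T" "b' \<in> T"
      and angles: "a < m" "m < a'" "a' \<le> b" "b < n" "n < b'" "b' < a + 2 * pi" for r r' m n a a' b b'
  proof
    assume eq: "r = r'"
    have r: "r \<in> R" using rays(1) by (simp add: ray_enters_def)
    show False
    proof (rule ray_not_between_borders[OF r assms(1) angles rays(1) rays(2)[folded eq]])
      fix x assume "x \<in> {a, b, b'}"
      then have "x \<in> T" using that(3-5) by blast
      then show "\<forall>\<^sub>F \<tau> in at_right 0. v + (2 * sin \<tau>) *\<^sub>R dir x \<notin> r" by (rule out_T[OF r])
    qed
  qed
  \<comment> \<open>Bisectors of the sectors; the last sector runs from \<open>t\<^sub>3\<close> to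
    \<open>t\<^sub>0 + 2 * pi\<close>.\<close>
  define m\<^sub>0 m\<^sub>1 m\<^sub>2 m\<^sub>3 where m_def: "m\<^sub>0 = (t\<^sub>0 + t\<^sub>1) / 2" "m\<^sub>1 = (t\<^sub>1 + t\<^sub>2) / 2" "m\<^sub>2 = (t\<^sub>2 + t\<^sub>3) / 2"
    "m\<^sub>3 = (t\<^sub>3 + t\<^sub>0 + 2 * pi) / 2"
  have m: "t\<^sub>0 < m\<^sub>0" "m\<^sub>0 < t\<^sub>1" "t\<^sub>1 < m\<^sub>1" "m\<^sub>1 < t\<^sub>2" "t\<^sub>2 < m\<^sub>2" "m\<^sub>2 < t\<^sub>3" "t\<^sub>3 < m\<^sub>3" "m\<^sub>3 < t\<^sub>0 + 2 * pi"
    using t t3 by (auto simp: m_def field_simps)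
  obtain r\<^sub>0 where r0: "ray_enters v m\<^sub>0 1 r\<^sub>0" "v \<in> closure r\<^sub>0" by (rule ray_enters_exists)
  obtain r\<^sub>1 where r1: "ray_enters v m\<^sub>1 1 r\<^sub>1" "v \<in> closure r\<^sub>1" by (rule ray_enters_exists)
  obtain r\<^sub>2 where r2: "ray_enters v m\<^sub>2 1 r\<^sub>2" "v \<in> closure r\<^sub>2" by (rule ray_enters_exists)
  obtain r\<^sub>3 where r3: "ray_enters v m\<^sub>3 1 r\<^sub>3" "v \<in> closure r\<^sub>3" by (rule ray_enters_exists)
  have r0': "ray_enters v (m\<^sub>0 + 2 * pi) 1 r\<^sub>0" using r0(1) by (simp add: ray_enters_add_2pi)
  have R: "r\<^sub>0 \<in> R" "r\<^sub>1 \<in> R" "r\<^sub>2 \<in> R" "r\<^sub>3 \<in> R"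
    using r0 r1 r2 r3 by (auto simp: ray_enters_def)
  have neq: "r\<^sub>0 \<noteq> r\<^sub>1" "r\<^sub>0 \<noteq> r\<^sub>2" "r\<^sub>1 \<noteq> r\<^sub>2" "r\<^sub>1 \<noteq> r\<^sub>3" "r\<^sub>2 \<noteq> r\<^sub>3" "r\<^sub>3 \<noteq> r\<^sub>0"
    using m t(5-7) t3
    by (intro sep[OF r0(1) r1(1) T(1,2,3), of t\<^sub>1] sep[OF r0(1) r2(1) T(1,3,4), of t\<^sub>1]
        sep[OF r1(1) r2(1) T(2,3,4), of t\<^sub>2] sep[OF r1(1) r3(1) T(2,4,5), of t\<^sub>2]
        sep[OF r2(1) r3(1) T(3,4,5), of t\<^sub>3] sep[OF r3(1) r0' T(4,5,6), of "t\<^sub>0 + 2 * pi"]; linarith)+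
  have "distinct [region_colour r\<^sub>0, region_colour r\<^sub>1, region_colour r\<^sub>2, region_colour r\<^sub>3]"
    using region_colour_neq[OF _ _ _ assms(1)] R r0(2) r1(2) r2(2) r3(2) neq by auto
  then show ?thesis
    by (intro card_ge_4[OF finite_colours_at]) (use R r0 r1 r2 r3 in \<open>auto simp: colours_at_def\<close>)
qed

end

subsection \<open>Planes with at most six colours\<close>

locale six_coloured_plane = polygon_coloured_plane \<alpha> V B R
  for \<alpha> :: "real^2 \<Rightarrow> 'c" and V B R +
  assumes card_colours: "card (range \<alpha>) \<le> 6"
begin

section \<open>Colour changes on the unit circle around a crowded point\<close>

definition missing_colours :: "real^2 \<Rightarrow> 'c set" where
  "missing_colours p = range \<alpha> - colours_at p"

text \<open>With at most six colours, four colours at \<open>p\<close> leave at most two for the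
  unit circle around \<open>p\<close>.\<close>

definition crowded :: "real^2 \<Rightarrow> bool" where
  "crowded p \<longleftrightarrow> card (colours_at p) \<ge> 4"

definition turns :: "real^2 \<Rightarrow> real \<Rightarrow> bool" where
  "turns c \<phi> \<longleftrightarrow> arc_colour c \<phi> 1 \<noteq> arc_colour c \<phi> (-1)"

lemma arc_colour_missing: "s = 1 \<or> s = -1 \<Longrightarrow> arc_colour c \<phi> s \<in> missing_colours c"
  using arc_colour_in_range arc_colour_notin_colours_at by (simp add: missing_colours_def)

lemma finite_missing: "finite (missing_colours c)"
  using finite_colours by (simp add: missing_colours_def)

text \<open>Six minus four bounds the number from above; two arcs sixty degrees apart exhibit two
  different missing colours.\<close>

lemma card_missing:
  assumes "crowded c"
  shows "card (missing_colours c) = 2"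
proof (rule antisym)
  show "card (missing_colours c) \<le> 2"
    using card_colours assms finite_colours_at colours_at_subset
    by (simp add: missing_colours_def crowded_def card_Diff_subset)
  have "card {arc_colour c (0 + pi/3) 1, arc_colour c 0 1} = 2"
    using arc_colour_sixty[of 1 c 0] by simp
  then show "2 \<le> card (missing_colours c)"
    using card_mono[OF finite_missing, of "{arc_colour c (0 + pi/3) 1, arc_colour c 0 1}" c]
      arc_colour_missing[of 1 c] by simp
qed

lemma missing_colours_eq:
  assumes "crowded c" "turns c \<phi>"
  shows "missing_colours c = {arc_colour c \<phi> 1, arc_colour c \<phi> (-1)}"
proof (rule card_subset_eq[symmetric, OF finite_missing])
  show "card {arc_colour c \<phi> 1, arc_colour c \<phi> (-1)} = card (missing_colours c)"
    using assms card_missing by (simp add: turns_def)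
qed (simp add: arc_colour_missing)

text \<open>Without a turn the arc colour would be locally constant in the angle, hence constant on
  the line, although it differs at angles \<open>pi/3\<close> apart.\<close>

lemma turns_exists:
  assumes "crowded c"
  obtains \<phi> where "turns c \<phi>"
proof -
  have "\<exists>\<phi>. turns c \<phi>"
  proof (rule ccontr)
    assume "\<nexists>\<phi>. turns c \<phi>"
    then have eq: "arc_colour c \<phi> (-1) = arc_colour c \<phi> 1" for \<phi>
      by (simp add: turns_def)
    let ?f = "\<lambda>\<phi>. arc_colour c \<phi> 1"
    have "\<forall>\<^sub>F \<theta> in at \<phi>. ?f \<phi> = ?f \<theta>" for \<phi>
    proof -
      \<comment> \<open>Shortly after \<open>\<phi>\<close> in direction \<open>s\<close> the circle
        is still in the same region, so the arc colour in direction \<open>s\<close> persists;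
        \<open>eq\<close> transfers this to direction \<open>1\<close>.\<close>
      have side: "\<exists>b>0. \<forall>t. 0 < t \<and> t < b \<longrightarrow> ?f (\<phi> + s * t) = ?f \<phi>" if s: "s = 1 \<or> s = -1" for s
      proof -
        let ?r = "arc_region c \<phi> s"
        have "\<forall>\<^sub>F t in at_right 0. c + dir (\<phi> + s * t) \<in> ?r"
          using arc_enters_region[OF s] by (simp add: arc_enters_def)
        then obtain b where b: "b > 0" "\<And>t. 0 < t \<Longrightarrow> t < b \<Longrightarrow> c + dir (\<phi> + s * t) \<in> ?r"
          by (auto simp: eventually_at_right_field)
        have "?f (\<phi> + s * t) = ?f \<phi>" if t: "0 < t" "t < b" for t
        proof -
          define d where "d = min t (b - t)"
          have "d > 0" using t by (simp add: d_def)
          have "c + dir (\<phi> + s * t + s * u) \<in> ?r" if "0 < u" "u < d" for u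
            using b(2)[of "t + u"] that t by (simp add: d_def distrib_left add_ac)
          then have "arc_enters c (\<phi> + s * t) s ?r"
            using \<open>d > 0\<close> arc_region_in[OF s] by (auto simp: arc_enters_def eventually_at_right_field)
          then have "arc_colour c (\<phi> + s * t) s = arc_colour c \<phi> s"
            using s by (simp add: arc_colour_def arc_region_eqI)
          then show ?thesis using s eq by auto
        qed
        then show ?thesis using b(1) by blast
      qed
      obtain b where b: "b > 0" "\<forall>t. 0 < t \<and> t < b \<longrightarrow> ?f (\<phi> + t) = ?f \<phi>"
        using side[of 1] by auto
      obtain b' where b': "b' > 0" "\<forall>t. 0 < t \<and> t < b' \<longrightarrow> ?f (\<phi> - t) = ?f \<phi>"
        using side[of "-1"] by auto
      have "?f \<phi> = ?f \<theta>" if "\<theta> \<noteq> \<phi>" "dist \<theta> \<phi> < min b b'" for \<theta>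
        using b(2)[rule_format, of "\<theta> - \<phi>"] b'(2)[rule_format, of "\<phi> - \<theta>"] that
        by (cases "\<theta> > \<phi>") (auto simp: dist_real_def)
      then show ?thesis
        unfolding eventually_at using b(1) b'(1) by (intro exI[of _ "min b b'"]) auto
    qed
    then have "?f (0 + pi/3) = ?f 0"
      by (intro connected_local_const[of UNIV]) auto
    then show False using arc_colour_sixty[of 1 c 0] by simp
  qed
  then show ?thesis using that by blast
qed

text \<open>Only two colours are available, and in either direction of travel the colour changes
  after sixty degrees; so the two colours are exchanged.\<close>

lemma turns_sixty:
  assumes "crowded c" "turns c \<phi>"
  shows "turns c (\<phi> + pi/3)"
proof -
  have "arc_colour c (\<phi> + pi/3) s \<in> {arc_colour c \<phi> 1, arc_colour c \<phi> (-1)}" if "s = 1 \<or> s = -1" for s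
    using arc_colour_missing[OF that, of c "\<phi> + pi/3"] missing_colours_eq[OF assms] by simp
  from this[of 1] this[of "-1"] show ?thesis
    using arc_colour_sixty[of 1 c \<phi>] arc_colour_sixty[of "-1" c \<phi>] assms(2)
    by (auto simp: turns_def)
qed

text \<open>This excludes the missing colours of \<open>c\<close> from the unit circle around
  \<open>c + dir \<phi>\<close>.\<close>

lemma missing_subset_colours_at:
  assumes "crowded c" "turns c \<phi>"
  shows "missing_colours c \<subseteq> colours_at (c + dir \<phi>)"
  using missing_colours_eq[OF assms] arc_colour_in_colours_at by simp

text \<open>Around \<open>y\<close> the two unit circles centred at \<open>c\<close> and \<open>x\<close> cross, and the colours of their four
  arcs belong alternately to \<open>missing_colours c\<close> and to its complement.\<close>
lemma crowded_propagates:
  assumes "crowded c" "turns c \<phi>"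
  defines "x \<equiv> c + dir \<phi>" and "y \<equiv> c + dir (\<phi> + pi/3)"
  shows "crowded y" "turns x (\<phi> + 2*pi/3)"
proof -
  have turn: "turns c (\<phi> + pi/3)" using turns_sixty assms(1,2) .
  \<comment> \<open>The points \<open>c\<close>, \<open>x\<close>, \<open>y\<close> form an
    equilateral triangle of side one.\<close>
  have yx: "y = x + dir (\<phi> + 2*pi/3)" by (simp add: x_def y_def dir_sixty)
  define r\<^sub>1 r\<^sub>2 r\<^sub>3 r\<^sub>4 where r_def: "r\<^sub>1 = arc_region c (\<phi> + pi/3) (-1)" "r\<^sub>2 = arc_region x (\<phi> + 2*pi/3) (-1)"
    "r\<^sub>3 = arc_region c (\<phi> + pi/3) 1" "r\<^sub>4 = arc_region x (\<phi> + 2*pi/3) 1"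
  \<comment> \<open>Tangent directions at \<open>y\<close> in cyclic order: arcs of the circles
    around \<open>c\<close> and around \<open>x\<close> alternate.\<close>
  have rays: "ray_enters y (\<phi> + pi/3 - pi/2) (-1) r\<^sub>1" "ray_enters y (\<phi> + 2*pi/3 - pi/2) (-1) r\<^sub>2"
    "ray_enters y (\<phi> + pi/3 + pi/2) 1 r\<^sub>3" "ray_enters y (\<phi> + 2*pi/3 + pi/2) 1 r\<^sub>4"
    unfolding r_def by (intro ray_enters_arc_region; simp add: yx flip: y_def; simp add: y_def)+
  have clos: "y \<in> closure r\<^sub>1" "y \<in> closure r\<^sub>2" "y \<in> closure r\<^sub>3" "y \<in> closure r\<^sub>4"
    unfolding r_def using closure_arc_region[of _ c "\<phi> + pi/3"] closure_arc_region[of _ x "\<phi> + 2*pi/3"]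
    by (simp_all add: y_def[symmetric] yx[symmetric])
  have R: "r\<^sub>1 \<in> R" "r\<^sub>2 \<in> R" "r\<^sub>3 \<in> R" "r\<^sub>4 \<in> R" by (simp_all add: r_def arc_region_in)
  have c13: "region_colour r\<^sub>1 \<in> missing_colours c" "region_colour r\<^sub>3 \<in> missing_colours c"
    using arc_colour_missing[of _ c] by (simp_all add: r_def flip: arc_colour_def)
  have "region_colour r\<^sub>2 \<notin> colours_at x" "region_colour r\<^sub>4 \<notin> colours_at x"
    using arc_colour_notin_colours_at[of _ x] by (simp_all add: r_def flip: arc_colour_def)
  then have c24: "region_colour r\<^sub>2 \<notin> missing_colours c" "region_colour r\<^sub>4 \<notin> missing_colours c"
    using missing_subset_colours_at[OF assms(1,2)] by (auto simp: x_def)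
  have neq: "r\<^sub>1 \<noteq> r\<^sub>2" "r\<^sub>2 \<noteq> r\<^sub>3" "r\<^sub>3 \<noteq> r\<^sub>4" "r\<^sub>4 \<noteq> r\<^sub>1" using c13 c24 by auto
  have angles: "\<phi> + pi/3 - pi/2 < \<phi> + 2*pi/3 - pi/2" "\<phi> + 2*pi/3 - pi/2 < \<phi> + pi/3 + pi/2"
    "\<phi> + pi/3 + pi/2 < \<phi> + 2*pi/3 + pi/2" "\<phi> + 2*pi/3 + pi/2 < \<phi> + pi/3 - pi/2 + 2*pi"
    "\<phi> + pi/3 - pi/2 + 2*pi < \<phi> + 2*pi/3 - pi/2 + 2*pi"
    using pi_gt_zero by (simp_all add: field_simps)
  \<comment> \<open>At a point that is not a vertex, borders leave in at most two directions, too
    few to separate the four arcs.\<close>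
  have "y \<in> V"
  proof (rule ccontr)
    assume "y \<notin> V"
    show False
      by (rule no_four_rays[OF thin_at_border[OF \<open>y \<notin> V\<close>] _ _ rays angles(1-4) neq(1-3)])
        (intro frontier_region_subset R)+
  qed
  \<comment> \<open>The same count for the frontier of a single region, starting at
    \<open>r\<^sub>2\<close> and taking \<open>r\<^sub>1\<close> one turn later.\<close>
  have "r\<^sub>2 \<noteq> r\<^sub>4"
  proof
    assume "r\<^sub>2 = r\<^sub>4"
    have "ray_enters y (\<phi> + pi/3 - pi/2 + 2*pi) (-1) r\<^sub>1"
      using rays(1) by (simp only: ray_enters_add_2pi)
    then show False
      using no_four_rays[OF thin_at_vertex[OF R(2) \<open>y \<in> V\<close>] _ _ rays(2-4) _ angles(2-5) neq(2-4)] \<open>r\<^sub>2 = r\<^sub>4\<close>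
      by blast
  qed
  moreover have "r\<^sub>1 \<noteq> r\<^sub>3" using turn by (auto simp: turns_def arc_colour_def r_def)
  ultimately have d: "distinct [region_colour r\<^sub>1, region_colour r\<^sub>2, region_colour r\<^sub>3, region_colour r\<^sub>4]"
    using region_colour_neq[OF _ _ _ \<open>y \<in> V\<close>] R clos neq by auto
  then show "crowded y"
    unfolding crowded_def
    by (intro card_ge_4[OF finite_colours_at]) (use R clos in \<open>auto simp: colours_at_def\<close>)
  show "turns x (\<phi> + 2*pi/3)"
    using d by (auto simp: turns_def arc_colour_def r_def)
qed

section \<open>The hexagon around a crowded vertex\<close>

text \<open>The circles around the hexagon corners pass through \<open>v\<close>. Their odd-numbered
  arcs there are separated by even-numbered ones, so they need three colours, but only two are
  available to them.\<close>

lemma no_crowded_vertex: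
  assumes "v \<in> V"
  shows "\<not> crowded v"
proof
  assume v: "crowded v"
  obtain \<phi> where \<phi>: "turns v \<phi>" using turns_exists[OF v] .
  \<comment> \<open>Angles are not reduced modulo a turn. The indices \<open>1\<close> to
    \<open>6\<close> list the corners once; index \<open>0\<close> is left out because
    \<open>crowded_propagates\<close> speaks of the next corner.\<close>
  define \<theta> where "\<theta> k = \<phi> + real k * (pi/3)" for k
  have \<theta>_Suc: "\<theta> (Suc k) = \<theta> k + pi/3" for k by (simp add: \<theta>_def algebra_simps)
  define x where "x k = v + dir (\<theta> k)" for k
  have turn: "turns v (\<theta> k)" for k
    by (induction k) (use \<phi> turns_sixty[OF v] in \<open>simp_all only: \<theta>_Suc\<close>, simp add: \<theta>_def)
  have crowded: "crowded (x (Suc k))" and turn_x: "turns (x k) (\<theta> k + 2*pi/3)" for k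
    using crowded_propagates[OF v turn[of k]] by (simp_all add: x_def \<theta>_Suc)
  have missing_v: "missing_colours (x k) \<inter> missing_colours v = {}" for k
    using missing_subset_colours_at[OF v turn[of k]] by (auto simp: x_def missing_colours_def)
  have missing_Suc: "missing_colours (x (Suc k)) \<inter> missing_colours (x (Suc (Suc k))) = {}" for k
  proof -
    have "x (Suc (Suc k)) = x (Suc k) + dir (\<theta> (Suc k) + 2*pi/3)"
      by (simp add: x_def \<theta>_Suc[of "Suc k"] dir_sixty)
    then show ?thesis
      using missing_subset_colours_at[OF crowded[of k] turn_x[of "Suc k"]] by (auto simp: missing_colours_def)
  qed
  \<comment> \<open>Of at most six colours, two are missing at \<open>v\<close> and two others at
    the middle corner; both neighbours of that corner must use the at most two that remain.\<close>
  have missing_eq: "missing_colours (x (Suc (Suc (Suc k)))) = missing_colours (x (Suc k))" for k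
  proof -
    let ?M = "\<lambda>i. missing_colours (x i)"
    let ?N = "range \<alpha> - missing_colours v - ?M (Suc (Suc k))"
    have sub: "missing_colours p \<subseteq> range \<alpha>" for p by (auto simp: missing_colours_def)
    have "?M (Suc (Suc k)) \<subseteq> range \<alpha> - missing_colours v"
      using sub[of "x (Suc (Suc k))"] missing_v[of "Suc (Suc k)"] by blast
    then have "card ?N = card (range \<alpha>) - 2 - 2"
      by (simp add: card_Diff_subset finite_missing sub card_missing v crowded)
    then have "card ?N \<le> 2"
      using card_colours by simp
    moreover have "finite ?N" using finite_colours by simp
    moreover have "?M (Suc k) \<subseteq> ?N"
      using sub[of "x (Suc k)"] missing_v[of "Suc k"] missing_Suc[of k] by blast
    moreover have "?M (Suc (Suc (Suc k))) \<subseteq> ?N"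
      using sub[of "x (Suc (Suc (Suc k)))"] missing_v[of "Suc (Suc (Suc k))"] missing_Suc[of "Suc k"] by blast
    moreover have "card (?M (Suc k)) = 2" "card (?M (Suc (Suc (Suc k)))) = 2"
      using card_missing crowded by simp_all
    ultimately have "?M (Suc k) = ?N" "?M (Suc (Suc (Suc k))) = ?N"
      using card_seteq[of ?N "?M (Suc k)"] card_seteq[of ?N "?M (Suc (Suc (Suc k)))"] by linarith+
    then show ?thesis by simp
  qed
  \<comment> \<open>Seen from \<open>x k\<close>, the point \<open>v\<close> has angle
    \<open>\<theta> k + pi\<close>; \<open>r k\<close> is the region in which the circle around
    \<open>x k\<close> leaves \<open>v\<close> counterclockwise.\<close>
  define r where "r k = arc_region (x k) (\<theta> k + pi) 1" for k
  have R: "r k \<in> R" for k by (simp add: r_def arc_region_in)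
  have v_eq: "v = x k + dir (\<theta> k + pi)" for k by (simp add: x_def)
  have ray: "ray_enters v (\<theta> k + 3*pi/2) 1 (r k)" for k
    unfolding r_def by (rule ray_enters_arc_region) (use v_eq in auto)
  have clos: "v \<in> closure (r k)" for k
  proof -
    have "x k + dir (\<theta> k + pi) \<in> closure (r k)"
      unfolding r_def by (rule closure_arc_region) simp
    then show ?thesis by (simp only: v_eq[symmetric])
  qed
  have col: "region_colour (r k) \<in> missing_colours (x k)" for k
    using arc_colour_missing[of 1 "x k"] by (simp add: r_def arc_colour_def)
  have odd: "region_colour (r 1) \<in> missing_colours (x 1)" "region_colour (r 3) \<in> missing_colours (x 1)"
    "region_colour (r 5) \<in> missing_colours (x 1)"
    using col[of 1] col[of 3] col[of 5] missing_eq[of 0] missing_eq[of 2] by (simp_all add: eval_nat_numeral)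
  have even: "region_colour (r 2) \<in> missing_colours (x 2)" "region_colour (r 4) \<in> missing_colours (x 2)"
    "region_colour (r 6) \<in> missing_colours (x 2)"
    using col[of 2] col[of 4] col[of 6] missing_eq[of 1] missing_eq[of 3] by (simp_all add: eval_nat_numeral)
  have disj: "missing_colours (x 1) \<inter> missing_colours (x 2) = {}"
    using missing_Suc[of 0] by (simp add: eval_nat_numeral)
  have neq: "r i \<noteq> r j"
    if "region_colour (r i) \<in> missing_colours (x 1)" "region_colour (r j) \<in> missing_colours (x 2)" for i j
    using that disj by auto
  \<comment> \<open>If \<open>r i\<close> and \<open>r k\<close> were the same region, small circles
    would meet its frontier between the arcs \<open>i\<close> and \<open>j\<close>, \<open>j\<close>
    and \<open>k\<close>, and \<open>k\<close> and \<open>l\<close>, once too often at a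
    vertex.\<close>
  have sep: "region_colour (r i) \<noteq> region_colour (r k)"
    if ijkl: "i < j" "j < k" "k < l" "l < i + 6" and rr: "r i \<noteq> r j" "r j \<noteq> r k" "r k \<noteq> r l" for i j k l
  proof -
    have \<theta>_mono: "\<theta> m < \<theta> n" if "m < n" for m n using that by (simp add: \<theta>_def)
    have "\<theta> l < \<theta> (i + 6)" using ijkl(4) by (rule \<theta>_mono)
    then have \<theta>_l: "\<theta> l < \<theta> i + 2*pi" by (simp add: \<theta>_def algebra_simps)
    have "r i \<noteq> r k"
    proof
      assume eq: "r i = r k"
      show False
      proof (rule no_four_rays[OF thin_at_vertex[OF R[of i] assms] order.refl _
            ray[of i] ray[of j] ray[of k] ray[of l] _ _ _ _ rr])
        show "frontier (r k) \<subseteq> frontier (r i)" by (simp add: eq)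
      qed (use \<theta>_mono ijkl(1-3) \<theta>_l in simp_all)
    qed
    then show ?thesis using region_colour_neq[OF R R _ assms clos clos] by blast
  qed
  have "region_colour (r 1) \<noteq> region_colour (r 3)"
    using neq[OF odd(1) even(1)] neq[OF odd(2) even(1)] neq[OF odd(2) even(2)] by (intro sep[of 1 2 3 4]) auto
  moreover have "region_colour (r 3) \<noteq> region_colour (r 5)"
    using neq[OF odd(2) even(2)] neq[OF odd(3) even(2)] neq[OF odd(3) even(3)] by (intro sep[of 3 4 5 6]) auto
  moreover have "region_colour (r 1) \<noteq> region_colour (r 5)"
    using neq[OF odd(1) even(1)] neq[OF odd(3) even(1)] neq[OF odd(3) even(3)] by (intro sep[of 1 2 5 6]) auto
  ultimately have "card {region_colour (r 1), region_colour (r 3), region_colour (r 5)} = 3" by simp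
  moreover have "card {region_colour (r 1), region_colour (r 3), region_colour (r 5)} \<le> card (missing_colours (x 1))"
    using odd by (intro card_mono finite_missing) auto
  ultimately show False using card_missing crowded[of 0] by simp
qed

end

theorem theorem1:
  fixes \<alpha> :: "real^2 \<Rightarrow> 'c"
    and V :: "(real^2) set" and B R :: "(real^2) set set" and v :: "real^2"
  assumes "polygon_coloring \<alpha> V B R"
    and "v \<in> V" and "vertex_degree B v \<ge> 4"
  shows "card (range \<alpha>) \<ge> 7"
proof (rule ccontr)
  assume "\<not> card (range \<alpha>) \<ge> 7"
  then interpret six_coloured_plane \<alpha> V B R
    using assms(1) by unfold_locales auto
  show False
    using no_crowded_vertex[OF assms(2)] card_colours_at_vertex[OF assms(2,3)] by (simp add: crowded_def)
qed

end
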